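(* Let $F:\mathbb{R}^2\to\mathbb{R}$, $F(x,y)=xy$, and let $\varepsilon>0$. Among parallelogram tilings, the optimal triangle density for continuous piecewise linear $\varepsilon$-approximations of $F$ is $\frac{\sqrt3}{8\,\varepsilon}$; that is, $\frac{\sqrt3}{8\varepsilon}$ is the infimum of $\delta(\mathcal T)$ over all parallelogram tilings $\mathcal T$ that admit a continuous piecewise linear $\varepsilon$-approximation of $F$. The optimal triangles have area $\frac{8\sqrt3}{3}\,\varepsilon$ and constant deviation $\Delta=\frac{\varepsilon}{3}$ at all vertices.
   Context: A triangle is the convex hull of three affinely independent points of $\mathbb{R}^2$. A triangulation of $\mathbb{R}^2$ is a locally finite family $\mathcal T$ of triangles covering $\mathbb{R}^2$ such that any two distinct members intersect in the empty set or in a common proper face (vertex or edge) of both. A parallelogram tiling is a triangulation of $\mathbb{R}^2$ consisting of translated copies of one triangle $T$ and of its point-reflection $T'=-T$, arranged so that $T$ and (a translate of) $T'$ form a parallelogram that tiles the plane by translation. A continuous piecewise linear $\varepsilon$-approximation of $F$ with respect to $\mathcal T$ is a continuous function $f:\mathbb{R}^2\to\mathbb{R}$ that is affine on each triangle of $\mathcal T$ and satisfies $|f-F|\le\varepsilon$ on $\mathbb{R}^2$. The deviation of $f$ at a vertex $v$ of $\mathcal T$ is $f(v)-F(v)$. The optimal triangles are the triangles of a parallelogram tiling attaining the optimal density, taken together with the corresponding approximation $f$. The triangle density of $\mathcal T$ is $\delta(\mathcal T)=\limsup_{\ell\to\infty}\frac{|\{S\in\mathcal T: S\cap Q_\ell\neq\emptyset\}|}{\ell^2}$,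 where $Q_\ell$ is the axis-parallel square of side length $\ell$ centered at the origin.
   Formalization: The deviation at all vertices is shown to be constantly ε/3 or constantly −ε/3 for every optimal tiling, with ε/3 attained by some optimum; reflecting (x,y)→(−x,y) turns an optimum with deviation ε/3 into one with −ε/3, so "always ε/3" fails. *)

theory Defs
  imports "HOL-Analysis.Analysis"
begin

text \<open>
  Triangles are the sets \<open>S\<close> with \<open>2 simplex S\<close>. The library predicate \<open>triangulation\<close> is
  restricted to finite families, so infinite triangulations of the plane get their own definition.
\<close>

definition plane_triangulation :: "(real^2) set set \<Rightarrow> bool" where
  "plane_triangulation \<T> \<longleftrightarrow>
     (\<forall>S\<in>\<T>. 2 simplex S) \<and>
     locally_finite_in euclidean \<T> \<and>
     \<Union>\<T> = UNIV \<and>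
     (\<forall>S\<in>\<T>. \<forall>S'\<in>\<T>. S \<noteq> S' \<longrightarrow>
        S \<inter> S' = {} \<or>
        (S \<inter> S') face_of S \<and> S \<inter> S' \<noteq> S \<and> (S \<inter> S') face_of S' \<and> S \<inter> S' \<noteq> S')"

definition triangulation_vertices :: "(real^2) set set \<Rightarrow> (real^2) set" where
  "triangulation_vertices \<T> = {v. \<exists>S\<in>\<T>. v extreme_point_of S}"

definition parallelogram :: "(real^2) set \<Rightarrow> bool" where
  "parallelogram P \<longleftrightarrow>
     (\<exists>p u v. u \<noteq> v \<and> independent {u, v} \<and> P = convex hull {p, p + u, p + v, p + u + v})"

definition tiles_plane_by_translation :: "(real^2) set \<Rightarrow> (real^2) set \<Rightarrow> bool" where
  "tiles_plane_by_translation P V \<longleftrightarrow>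
     (\<Union>v\<in>V. (+) v ` P) = UNIV \<and>
     (\<forall>v\<in>V. \<forall>w\<in>V. v \<noteq> w \<longrightarrow> interior ((+) v ` P) \<inter> interior ((+) w ` P) = {})"

text \<open>
  Here \<open>T'\<close> is the translate of the point-reflection of \<open>T\<close> that completes \<open>T\<close> to a parallelogram,
  and \<open>V\<close> is the set of translation vectors of the parallelograms.
\<close>

definition parallelogram_tiling :: "(real^2) set set \<Rightarrow> bool" where
  "parallelogram_tiling \<T> \<longleftrightarrow>
     plane_triangulation \<T> \<and>
     (\<exists>T T' c V. 2 simplex T \<and> T' = (+) c ` uminus ` T \<and>
        parallelogram (T \<union> T') \<and>
        tiles_plane_by_translation (T \<union> T') V \<and>
        \<T> = (\<lambda>v. (+) v ` T) ` V \<union> (\<lambda>v. (+) v ` T') ` V)"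

definition pl_approximation ::
    "real \<Rightarrow> (real^2 \<Rightarrow> real) \<Rightarrow> (real^2) set set \<Rightarrow> (real^2 \<Rightarrow> real) \<Rightarrow> bool" where
  "pl_approximation \<epsilon> F \<T> f \<longleftrightarrow>
     continuous_on UNIV f \<and>
     (\<forall>S\<in>\<T>. \<exists>h c. linear h \<and> (\<forall>x\<in>S. f x = h x + c)) \<and>
     (\<forall>x. \<bar>f x - F x\<bar> \<le> \<epsilon>)"

definition centered_square :: "real \<Rightarrow> (real^2) set" where
  "centered_square l = {p. \<forall>i. \<bar>p $ i\<bar> \<le> l / 2}"

text \<open>
  The cardinality below is that of a finite set whenever the family is locally finite, since the
  square is compact.
\<close>

definition triangle_density :: "(real^2) set set \<Rightarrow> ereal" where
  "triangle_density \<T> =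
     Limsup at_top (\<lambda>l::real.
       ereal (real (card {S\<in>\<T>. S \<inter> centered_square l \<noteq> {}}) / l\<^sup>2))"

definition optimal_density :: "real \<Rightarrow> (real^2 \<Rightarrow> real) \<Rightarrow> ereal" where
  "optimal_density \<epsilon> F =
     (INF \<T>\<in>{\<T>. parallelogram_tiling \<T> \<and> (\<exists>f. pl_approximation \<epsilon> F \<T> f)}. triangle_density \<T>)"

definition optimal_tiling ::
    "real \<Rightarrow> (real^2 \<Rightarrow> real) \<Rightarrow> (real^2) set set \<Rightarrow> (real^2 \<Rightarrow> real) \<Rightarrow> bool" where
  "optimal_tiling \<epsilon> F \<T> f \<longleftrightarrow>
     parallelogram_tiling \<T> \<and> pl_approximation \<epsilon> F \<T> f \<and>
     triangle_density \<T> = optimal_density \<epsilon> F"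

text \<open>
  The sign of a constant deviation depends on the orientation of the tiling: for \<open>F(x,y) = xy\<close> the
  reflection \<open>\<rho>(x,y) = (-x,y)\<close> satisfies \<open>F \<circ> \<rho> = -F\<close>, so it turns an approximation \<open>f\<close> of \<open>F\<close> into
  the approximation \<open>-(f \<circ> \<rho>)\<close> on the reflected tiling, whose deviations have the opposite sign.
\<close>

definition constant_deviation ::
    "(real^2 \<Rightarrow> real) \<Rightarrow> (real^2) set set \<Rightarrow> (real^2 \<Rightarrow> real) \<Rightarrow> real \<Rightarrow> bool" where
  "constant_deviation F \<T> f \<Delta> \<longleftrightarrow> (\<forall>v\<in>triangulation_vertices \<T>. f v - F v = \<Delta>)"

end

theory Submission
  imports Defs
begin

text \<open>
  For an edge with direction \<open>u\<close> put \<open>q = u\<^sub>1 u\<^sub>2\<close>. At the midpoint of the edge the error of a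
  piecewise linear \<open>f\<close> is the mean of the two deviations plus \<open>q/4\<close>. A tiling by \<open>T\<close> and \<open>-T\<close>
  contains with each triangle its point reflections in the midpoints of its edges; adding the midpoint
  estimates around a parallelogram eliminates the deviations and leaves \<open>\<bar>q\<^sub>i\<bar> \<le> 8\<epsilon>\<close> and
  \<open>\<bar>q\<^sub>i - q\<^sub>j\<bar> \<le> 8\<epsilon>\<close> for the three edges of \<open>T\<close>. The area satisfies
  \<open>4 A\<^sup>2 = q\<^sub>1\<^sup>2 + q\<^sub>2\<^sup>2 + q\<^sub>3\<^sup>2 - 2 (q\<^sub>1 q\<^sub>2 + q\<^sub>2 q\<^sub>3 + q\<^sub>3 q\<^sub>1)\<close>, whose maximum under these
  constraints is \<open>256 \<epsilon>\<^sup>2 / 3\<close>, attained only at \<open>\<plusminus>(8\<epsilon>/3, 8\<epsilon>/3, -16\<epsilon>/3)\<close>, where the midpoint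
  estimates force the deviations. For the converse, \<open>xy\<close> is a combination of the squares of the two
  lattice coordinates and of their sum, and each square is interpolated linearly between integers.
\<close>

subsection \<open>Triangles and their area\<close>

definition cross2 :: "real^2 \<Rightarrow> real^2 \<Rightarrow> real" where
  "cross2 u v = u $ 1 * v $ 2 - u $ 2 * v $ 1"

text \<open>On points this is \<open>F\<close> itself; on edge vectors it governs the error of
  linear interpolation along the edge.\<close>

definition xy :: "real^2 \<Rightarrow> real" where
  "xy u = u $ 1 * u $ 2"

lemma xy_minus_commute: "xy (u - v) = xy (v - u)"
  by (simp add: xy_def algebra_simps)

lemma cross2_eq_0_imp_scaleR:
  assumes "cross2 u v = 0" "u \<noteq> 0"
  shows "\<exists>k. v = k *\<^sub>R u"
proof -
  have *: "u $ 1 * v $ 2 = u $ 2 * v $ 1"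
    using assms(1) by (simp add: cross2_def)
  have "u $ 1 \<noteq> 0 \<or> u $ 2 \<noteq> 0"
    using assms(2) by (auto simp: vec_eq_iff forall_2)
  then show ?thesis
  proof
    assume "u $ 1 \<noteq> 0"
    then show ?thesis
      using * by (intro exI[of _ "v $ 1 / u $ 1"]) (simp add: vec_eq_iff forall_2 field_simps)
  next
    assume "u $ 2 \<noteq> 0"
    then show ?thesis
      using * by (intro exI[of _ "v $ 2 / u $ 2"]) (simp add: vec_eq_iff forall_2 field_simps)
  qed
qed

lemma cross2_nonzero_iff: "cross2 (b - a) (c - a) \<noteq> 0 \<longleftrightarrow> \<not> collinear {a, b, c}"
proof
  assume n0: "cross2 (b - a) (c - a) \<noteq> 0"
  show "\<not> collinear {a, b, c}"
  proof
    assume "collinear {a, b, c}"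
    then obtain u where u: "\<And>x y. x \<in> {a,b,c} \<Longrightarrow> y \<in> {a,b,c} \<Longrightarrow> \<exists>k. x - y = k *\<^sub>R u"
      unfolding collinear_def by blast
    obtain k l where "b - a = k *\<^sub>R u" "c - a = l *\<^sub>R u"
      using u[of b a] u[of c a] by auto
    then show False
      using n0 by (simp add: cross2_def)
  qed
next
  assume nc: "\<not> collinear {a, b, c}"
  show "cross2 (b - a) (c - a) \<noteq> 0"
  proof
    assume "cross2 (b - a) (c - a) = 0"
    moreover have "b - a \<noteq> 0"
      using nc by auto
    ultimately have "\<exists>k. c - a = k *\<^sub>R (b - a)"
      by (rule cross2_eq_0_imp_scaleR)
    then obtain k where "c - a = k *\<^sub>R (b - a)" by blast
    then have "collinear {0, b - a, c - a}"
      by (metis collinear_lemma)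
    then have "collinear {b, a, c}"
      by (subst collinear_3) auto
    then show False
      using nc by (simp add: insert_commute)
  qed
qed

lemma simplex_2_iff:
  "2 simplex S \<longleftrightarrow> (\<exists>a b c. cross2 (b - a) (c - a) \<noteq> 0 \<and> S = convex hull {a, b, c})"
proof -
  have three: "\<not> affine_dependent C \<and> card C = 3 \<longleftrightarrow> (\<exists>a b c. \<not> collinear {a, b, c} \<and> C = {a, b, c})"
    for C :: "(real^2) set"
    unfolding card_3_iff collinear_3_eq_affine_dependent by auto
  have "2 simplex S \<longleftrightarrow> (\<exists>C. (\<not> affine_dependent C \<and> card C = 3) \<and> S = convex hull C)"
    unfolding simplex_def by (intro arg_cong[where f = Ex] ext) auto
  also have "\<dots> \<longleftrightarrow> (\<exists>a b c. \<not> collinear {a, b, c} \<and> S = convex hull {a, b, c})"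
    unfolding three by auto
  finally show ?thesis
    by (simp add: cross2_nonzero_iff)
qed

lemma plane_triangulation_simplex: "plane_triangulation \<T> \<Longrightarrow> S \<in> \<T> \<Longrightarrow> 2 simplex S"
  by (simp add: plane_triangulation_def)

lemma plane_triangulation_cover: "plane_triangulation \<T> \<Longrightarrow> \<exists>S\<in>\<T>. x \<in> S"
  unfolding plane_triangulation_def by (metis UNIV_I UnionE)

lemma plane_triangulation_locally_finite:
  "plane_triangulation \<T> \<Longrightarrow> \<exists>U. open U \<and> x \<in> U \<and> finite {S \<in> \<T>. S \<inter> U \<noteq> {}}"
  by (simp add: plane_triangulation_def locally_finite_in_def)

lemma plane_triangulation_face:
  assumes "plane_triangulation \<T>" "S \<in> \<T>" "S' \<in> \<T>" "S \<noteq> S'" "S \<inter> S' \<noteq> {}"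
  shows "(S \<inter> S') face_of S" "S \<inter> S' \<noteq> S" "(S \<inter> S') face_of S'"
proof -
  have "\<forall>S\<in>\<T>. \<forall>S'\<in>\<T>. S \<noteq> S' \<longrightarrow> S \<inter> S' = {} \<or>
      (S \<inter> S') face_of S \<and> S \<inter> S' \<noteq> S \<and> (S \<inter> S') face_of S' \<and> S \<inter> S' \<noteq> S'"
    using assms(1) by (simp add: plane_triangulation_def)
  from this[rule_format, OF assms(2,3,4)] assms(5)
  show "(S \<inter> S') face_of S" "S \<inter> S' \<noteq> S" "(S \<inter> S') face_of S'"
    by simp_all
qed

lemma affine_independent_triangle:
  "cross2 (b - a) (c - a) \<noteq> 0 \<Longrightarrow> \<not> affine_dependent {a, b, c}"
  by (simp add: cross2_nonzero_iff collinear_3_eq_affine_dependent)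

lemma extreme_point_of_triangle:
  "cross2 (b - a) (c - a) \<noteq> 0 \<Longrightarrow> x extreme_point_of convex hull {a, b, c} \<longleftrightarrow> x = a \<or> x = b \<or> x = c"
  by (simp add: affine_independent_triangle extreme_point_of_convex_hull_affine_independent)

lemma content_triangle_cross2:
  "measure lborel (convex hull {a, b, c}) = \<bar>cross2 (b - a) (c - a)\<bar> / 2"
  by (simp add: content_triangle cross2_def algebra_simps)

text \<open>By polarization the three edge values determine the Gram matrix of the form
  \<open>xy\<close> on the vectors \<open>b - a\<close> and \<open>c - a\<close>; the squared cross
  product is -4 times its determinant.\<close>

lemma cross2_square:
  "(cross2 (b - a) (c - a))\<^sup>2 =
     (xy (b - a))\<^sup>2 + (xy (c - b))\<^sup>2 + (xy (c - a))\<^sup>2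
     - 2 * (xy (b - a) * xy (c - b) + xy (c - b) * xy (c - a) + xy (c - a) * xy (b - a))"
  by (simp add: cross2_def xy_def algebra_simps power2_eq_square)

text \<open>
  The polynomial below is convex in each variable, so on a cube \<open>[-n, M]\<^sup>3\<close> with \<open>M + n = 8\<epsilon>\<close> it is
  largest at a vertex; the best vertex is \<open>(M, M, -n)\<close> with value \<open>n (n + 4 M)\<close>, maximal at
  \<open>n = 16\<epsilon>/3\<close>, or its negative.
\<close>

lemma area_polynomial_le_mixed:
  fixes q1 q2 n e :: real
  assumes e: "e > 0" and q: "0 \<le> q2" "q2 \<le> q1" "0 \<le> n" "q1 + n \<le> 8 * e"
  defines "G \<equiv> q1\<^sup>2 + q2\<^sup>2 + n\<^sup>2 - 2 * (q1 * q2 - q2 * n - n * q1)"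
  shows "G \<le> 256 / 3 * e\<^sup>2" "G = 256 / 3 * e\<^sup>2 \<Longrightarrow> q1 = 8 / 3 * e \<and> q2 = 8 / 3 * e \<and> n = 16 / 3 * e"
proof -
  \<comment> \<open>Two expansions, around the values at \<open>q2 = q1\<close> and at
    \<open>q2 = 0\<close>: the correction in the first is nonpositive while
    \<open>q1 - q2 \<le> 2 * n\<close>, and beyond that the correction in the second is.\<close>
  have G1: "G = n\<^sup>2 + 4 * n * q1 + (q1 - q2) * (q1 - q2 - 2 * n)"
    by (simp add: G_def algebra_simps power2_eq_square)
  have G2: "G = (n + q1)\<^sup>2 - q2 * (2 * q1 - q2 - 2 * n)"
    by (simp add: G_def algebra_simps power2_eq_square)
  have sq: "(n + q1)\<^sup>2 \<le> 64 * e\<^sup>2"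
    using power_mono[of "n + q1" "8 * e" 2] q by (simp add: power_mult_distrib add.commute)
  have e2: "64 * e\<^sup>2 < 256 / 3 * e\<^sup>2"
    using e by simp
  \<comment> \<open>Completing the square in \<open>n\<close>; the factor
    \<open>8 * e - n - q1\<close> is the slack in the constraint on \<open>q1 + n\<close>.\<close>
  have vertex: "n\<^sup>2 + 4 * n * q1 \<le> 256 / 3 * e\<^sup>2 - 3 * (n - 16 / 3 * e)\<^sup>2 - 4 * n * (8 * e - n - q1)"
    by (simp add: algebra_simps power2_eq_square)
  have tail: "0 \<le> 3 * (n - 16 / 3 * e)\<^sup>2" "0 \<le> 4 * n * (8 * e - n - q1)"
    using q by simp_all
  have far: "G < 256 / 3 * e\<^sup>2" if "q1 - q2 > 2 * n"
  proof -
    have "0 \<le> q2 * (2 * q1 - q2 - 2 * n)"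
      using that q by (intro mult_nonneg_nonneg) auto
    then show ?thesis
      using G2 sq e2 by linarith
  qed
  have near: "(q1 - q2) * (q1 - q2 - 2 * n) \<le> 0" if "q1 - q2 \<le> 2 * n"
    using that q by (intro mult_nonneg_nonpos) auto
  show le: "G \<le> 256 / 3 * e\<^sup>2"
  proof (cases "q1 - q2 \<le> 2 * n")
    case True
    then show ?thesis using near G1 vertex tail by linarith
  next
    case False
    then show ?thesis using far by linarith
  qed
  show "q1 = 8 / 3 * e \<and> q2 = 8 / 3 * e \<and> n = 16 / 3 * e" if "G = 256 / 3 * e\<^sup>2"
  proof -
    have nr: "q1 - q2 \<le> 2 * n"
      using far that by fastforce
    \<comment> \<open>At the maximum every loss vanishes. The first gives \<open>n\<close>, then
      \<open>n > 0\<close> gives \<open>q1\<close>; as \<open>q2 \<ge> 0\<close> and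
      \<open>q1 < 2 * n\<close>, the last one leaves only \<open>q2 = q1\<close>.\<close>
    have "3 * (n - 16 / 3 * e)\<^sup>2 = 0" "4 * n * (8 * e - n - q1) = 0" "(q1 - q2) * (q1 - q2 - 2 * n) = 0"
      using near[OF nr] G1 vertex tail that by linarith+
    then show ?thesis
      using e q by auto
  qed
qed

text \<open>If \<open>x\<close> is the largest variable, the polynomial is
  \<open>(x - y - z)^2 - 4 y z\<close> with \<open>\<bar>x - y - z\<bar> \<le> x\<close>. The
  resulting bound \<open>64 e^2\<close> lies strictly below the mixed-sign maximum, so an extremal
  triple has mixed signs.\<close>

lemma area_polynomial_le_nonneg:
  fixes q1 q2 q3 e :: real
  assumes e: "e > 0" and q: "0 \<le> q1" "0 \<le> q2" "0 \<le> q3" "q1 \<le> 8 * e" "q2 \<le> 8 * e" "q3 \<le> 8 * e"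
  shows "q1\<^sup>2 + q2\<^sup>2 + q3\<^sup>2 - 2 * (q1 * q2 + q2 * q3 + q3 * q1) < 256 / 3 * e\<^sup>2"
proof -
  have *: "x\<^sup>2 + y\<^sup>2 + z\<^sup>2 - 2 * (x * y + y * z + z * x) \<le> 64 * e\<^sup>2"
    if "0 \<le> y" "0 \<le> z" "y \<le> x" "z \<le> x" "x \<le> 8 * e" for x y z :: real
  proof -
    have "x\<^sup>2 + y\<^sup>2 + z\<^sup>2 - 2 * (x * y + y * z + z * x) = (x - y - z)\<^sup>2 - 4 * (y * z)"
      by (simp add: algebra_simps power2_eq_square)
    also have "\<dots> \<le> (x - y - z)\<^sup>2"
      using that by simp
    also have "\<dots> \<le> (8 * e)\<^sup>2"
      using that e by (intro power2_le_iff_abs_le[THEN iffD2]) auto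
    finally show ?thesis by (simp add: power_mult_distrib)
  qed
  have "q1\<^sup>2 + q2\<^sup>2 + q3\<^sup>2 - 2 * (q1 * q2 + q2 * q3 + q3 * q1) \<le> 64 * e\<^sup>2"
    using *[of q2 q3 q1] *[of q3 q1 q2] *[of q1 q2 q3] q by argo
  also have "64 * e\<^sup>2 < 256 / 3 * e\<^sup>2"
    using e by simp
  finally show ?thesis .
qed

text \<open>The polynomial is symmetric and even, and two of three reals always share a weak sign. A
  permutation and a common sign change \<open>\<sigma>\<close> therefore reduce everything to two
  nonnegative variables.\<close>

lemma area_polynomial_le:
  fixes q1 q2 q3 e :: real
  assumes e: "e > 0"
    and b: "\<bar>q1\<bar> \<le> 8 * e" "\<bar>q2\<bar> \<le> 8 * e" "\<bar>q3\<bar> \<le> 8 * e"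
    and d: "\<bar>q1 - q2\<bar> \<le> 8 * e" "\<bar>q2 - q3\<bar> \<le> 8 * e" "\<bar>q3 - q1\<bar> \<le> 8 * e"
  defines "G \<equiv> q1\<^sup>2 + q2\<^sup>2 + q3\<^sup>2 - 2 * (q1 * q2 + q2 * q3 + q3 * q1)"
  shows "G \<le> 256 / 3 * e\<^sup>2"
    and "G = 256 / 3 * e\<^sup>2 \<Longrightarrow> \<exists>\<sigma>\<in>{1, -1}.
      (q1, q2, q3) \<in> {(\<sigma> * (8 / 3 * e), \<sigma> * (8 / 3 * e), - \<sigma> * (16 / 3 * e)),
        (\<sigma> * (8 / 3 * e), - \<sigma> * (16 / 3 * e), \<sigma> * (8 / 3 * e)),
        (- \<sigma> * (16 / 3 * e), \<sigma> * (8 / 3 * e), \<sigma> * (8 / 3 * e))}"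
proof -
  define g where "g x y z = x\<^sup>2 + y\<^sup>2 + z\<^sup>2 - 2 * (x * y + y * z + z * x)" for x y z :: real
  have G: "G = g q1 q2 q3" by (simp add: G_def g_def)
  have mixed: "g x y z \<le> 256 / 3 * e\<^sup>2 \<and>
      (g x y z = 256 / 3 * e\<^sup>2 \<longrightarrow> x = 8 / 3 * e \<and> y = 8 / 3 * e \<and> z = - (16 / 3 * e))"
    if "0 \<le> x" "0 \<le> y" "z \<le> 0" "x - z \<le> 8 * e" "y - z \<le> 8 * e" for x y z
    using area_polynomial_le_mixed[OF e, of y x "-z"] area_polynomial_le_mixed[OF e, of x y "-z"] that
    by (cases "y \<le> x") (auto simp: g_def algebra_simps)
  have two_pos: "g x y z \<le> 256 / 3 * e\<^sup>2 \<and>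
      (g x y z = 256 / 3 * e\<^sup>2 \<longrightarrow> x = 8 / 3 * e \<and> y = 8 / 3 * e \<and> z = - (16 / 3 * e))"
    if "0 \<le> x" "0 \<le> y" "\<bar>x\<bar> \<le> 8 * e" "\<bar>y\<bar> \<le> 8 * e" "\<bar>z\<bar> \<le> 8 * e"
      "\<bar>x - z\<bar> \<le> 8 * e" "\<bar>y - z\<bar> \<le> 8 * e" for x y z
  proof (cases "z \<le> 0")
    case True
    then show ?thesis using mixed[of x y z] that by linarith
  next
    case False
    then show ?thesis using area_polynomial_le_nonneg[OF e, of x y z] that by (auto simp: g_def)
  qed
  consider "q1 \<ge> 0" "q2 \<ge> 0" | "q1 \<ge> 0" "q3 \<ge> 0" | "q2 \<ge> 0" "q3 \<ge> 0"
    | "q1 \<le> 0" "q2 \<le> 0" | "q1 \<le> 0" "q3 \<le> 0" | "q2 \<le> 0" "q3 \<le> 0"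
    by linarith
  then have "G \<le> 256 / 3 * e\<^sup>2 \<and> (G = 256 / 3 * e\<^sup>2 \<longrightarrow> (\<exists>\<sigma>\<in>{1, -1}.
      (q1, q2, q3) \<in> {(\<sigma> * (8 / 3 * e), \<sigma> * (8 / 3 * e), - \<sigma> * (16 / 3 * e)),
        (\<sigma> * (8 / 3 * e), - \<sigma> * (16 / 3 * e), \<sigma> * (8 / 3 * e)),
        (- \<sigma> * (16 / 3 * e), \<sigma> * (8 / 3 * e), \<sigma> * (8 / 3 * e))}))"
  proof cases
    case 1
    have G': "G = g q1 q2 q3"
      by (simp add: G g_def algebra_simps)
    have "g q1 q2 q3 \<le> 256 / 3 * e\<^sup>2 \<and>
        (g q1 q2 q3 = 256 / 3 * e\<^sup>2 \<longrightarrow> q1 = 8 / 3 * e \<and> q2 = 8 / 3 * e \<and> q3 = - (16 / 3 * e))"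
      by (rule two_pos) (use 1 b d in linarith)+
    then show ?thesis
      unfolding G'[symmetric] by (auto intro!: bexI[of _ "1"])
  next
    case 2
    have G': "G = g q3 q1 q2"
      by (simp add: G g_def algebra_simps)
    have "g q3 q1 q2 \<le> 256 / 3 * e\<^sup>2 \<and>
        (g q3 q1 q2 = 256 / 3 * e\<^sup>2 \<longrightarrow> q3 = 8 / 3 * e \<and> q1 = 8 / 3 * e \<and> q2 = - (16 / 3 * e))"
      by (rule two_pos) (use 2 b d in linarith)+
    then show ?thesis
      unfolding G'[symmetric] by (auto intro!: bexI[of _ "1"])
  next
    case 3
    have G': "G = g q2 q3 q1"
      by (simp add: G g_def algebra_simps)
    have "g q2 q3 q1 \<le> 256 / 3 * e\<^sup>2 \<and>
        (g q2 q3 q1 = 256 / 3 * e\<^sup>2 \<longrightarrow> q2 = 8 / 3 * e \<and> q3 = 8 / 3 * e \<and> q1 = - (16 / 3 * e))"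
      by (rule two_pos) (use 3 b d in linarith)+
    then show ?thesis
      unfolding G'[symmetric] by (auto intro!: bexI[of _ "1"])
  next
    case 4
    have G': "G = g (- q1) (- q2) (- q3)"
      by (simp add: G g_def algebra_simps)
    have "g (- q1) (- q2) (- q3) \<le> 256 / 3 * e\<^sup>2 \<and>
        (g (- q1) (- q2) (- q3) = 256 / 3 * e\<^sup>2 \<longrightarrow> (- q1) = 8 / 3 * e \<and> (- q2) = 8 / 3 * e \<and> (- q3) = - (16 / 3 * e))"
      by (rule two_pos) (use 4 b d in linarith)+
    note opt = this[folded G']
    have "q1 = - (8 / 3 * e) \<and> q2 = - (8 / 3 * e) \<and> q3 = 16 / 3 * e" if "G = 256 / 3 * e\<^sup>2"
      using conjunct2[OF opt, rule_format, OF that] by (intro conjI; linarith)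
    with opt show ?thesis
      by (intro conjI impI bexI[of _ "-1"]) auto
  next
    case 5
    have G': "G = g (- q3) (- q1) (- q2)"
      by (simp add: G g_def algebra_simps)
    have "g (- q3) (- q1) (- q2) \<le> 256 / 3 * e\<^sup>2 \<and>
        (g (- q3) (- q1) (- q2) = 256 / 3 * e\<^sup>2 \<longrightarrow> (- q3) = 8 / 3 * e \<and> (- q1) = 8 / 3 * e \<and> (- q2) = - (16 / 3 * e))"
      by (rule two_pos) (use 5 b d in linarith)+
    note opt = this[folded G']
    have "q3 = - (8 / 3 * e) \<and> q1 = - (8 / 3 * e) \<and> q2 = 16 / 3 * e" if "G = 256 / 3 * e\<^sup>2"
      using conjunct2[OF opt, rule_format, OF that] by (intro conjI; linarith)
    with opt show ?thesis
      by (intro conjI impI bexI[of _ "-1"]) auto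
  next
    case 6
    have G': "G = g (- q2) (- q3) (- q1)"
      by (simp add: G g_def algebra_simps)
    have "g (- q2) (- q3) (- q1) \<le> 256 / 3 * e\<^sup>2 \<and>
        (g (- q2) (- q3) (- q1) = 256 / 3 * e\<^sup>2 \<longrightarrow> (- q2) = 8 / 3 * e \<and> (- q3) = 8 / 3 * e \<and> (- q1) = - (16 / 3 * e))"
      by (rule two_pos) (use 6 b d in linarith)+
    note opt = this[folded G']
    have "q2 = - (8 / 3 * e) \<and> q3 = - (8 / 3 * e) \<and> q1 = 16 / 3 * e" if "G = 256 / 3 * e\<^sup>2"
      using conjunct2[OF opt, rule_format, OF that] by (intro conjI; linarith)
    with opt show ?thesis
      by (intro conjI impI bexI[of _ "-1"]) auto
  qed
  note concl = this
  show "G \<le> 256 / 3 * e\<^sup>2"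
    by (rule concl[THEN conjunct1])
  show "G = 256 / 3 * e\<^sup>2 \<Longrightarrow> \<exists>\<sigma>\<in>{1, -1}.
      (q1, q2, q3) \<in> {(\<sigma> * (8 / 3 * e), \<sigma> * (8 / 3 * e), - \<sigma> * (16 / 3 * e)),
        (\<sigma> * (8 / 3 * e), - \<sigma> * (16 / 3 * e), \<sigma> * (8 / 3 * e)),
        (- \<sigma> * (16 / 3 * e), \<sigma> * (8 / 3 * e), \<sigma> * (8 / 3 * e))}"
    by (rule concl[THEN conjunct2, THEN mp])
qed

subsection \<open>Reflection across edges\<close>

lemma uminus_convex_hull: "uminus ` (convex hull S) = convex hull (uminus ` S)"
  for S :: "'a::real_vector set"
  by (rule convex_hull_linear_image) (simp add: linear_uminus)

lemma convex_hull_reflect: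
  "(\<lambda>x. z - x) ` (convex hull S) = convex hull ((\<lambda>x. z - x) ` S)" for z :: "'a::real_vector"
proof -
  have "(\<lambda>x. z - x) ` A = (+) z ` uminus ` A" for A
    by (simp add: image_image)
  then show ?thesis
    by (simp add: uminus_convex_hull convex_hull_translation)
qed

text \<open>Members are images of \<open>T\<close> under maps \<open>x \<mapsto> v + x\<close> or
  \<open>x \<mapsto> v - x\<close>, and these maps form a group. This makes any one member a
  reference triangle for all the others.\<close>

lemma parallelogram_tiling_homothetic:
  assumes "parallelogram_tiling \<T>" "convex hull {a, b, c} \<in> \<T>" "S \<in> \<T>"
  shows "\<exists>z. S = convex hull {z + a, z + b, z + c} \<or> S = convex hull {z - a, z - b, z - c}"
proof -
  obtain T T' c' V where T': "T' = (+) c' ` uminus ` T"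
    and \<T>: "\<T> = (\<lambda>v. (+) v ` T) ` V \<union> (\<lambda>v. (+) v ` T') ` V"
    using assms(1) unfolding parallelogram_tiling_def by blast
  have *: "\<exists>\<sigma>\<in>{1, -1::real}. \<exists>v. R = (\<lambda>x. v + \<sigma> *\<^sub>R x) ` T" if "R \<in> \<T>" for R
    using that unfolding \<T>
  proof
    assume "R \<in> (\<lambda>v. (+) v ` T) ` V"
    then show ?thesis
      by (intro bexI[of _ 1]) auto
  next
    assume "R \<in> (\<lambda>v. (+) v ` T') ` V"
    then obtain v where "R = (+) v ` T'" by blast
    then have "R = (\<lambda>x. (v + c') + (-1) *\<^sub>R x) ` T"
      by (simp add: T' image_image algebra_simps)
    then show ?thesis
      by blast
  qed
  obtain s u where s: "s \<in> {1, -1}" "convex hull {a, b, c} = (\<lambda>x. u + s *\<^sub>R x) ` T"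
    using *[OF assms(2)] by blast
  obtain t v where t: "t \<in> {1, -1}" "S = (\<lambda>x. v + t *\<^sub>R x) ` T"
    using *[OF assms(3)] by blast
  have "s * s = 1" using s by auto
  \<comment> \<open>Because \<open>s * s = 1\<close>, the inverse of
    \<open>x \<mapsto> u + s x\<close> is \<open>y \<mapsto> s (y - u)\<close>; substituting it
    gives the linear factor \<open>s * t\<close>.\<close>
  then have "(\<lambda>x. v + t *\<^sub>R x) = (\<lambda>y. (v - (s * t) *\<^sub>R u) + (s * t) *\<^sub>R y) \<circ> (\<lambda>x. u + s *\<^sub>R x)"
    by (simp add: fun_eq_iff algebra_simps)
  then have "S = (\<lambda>y. (v - (s * t) *\<^sub>R u) + (s * t) *\<^sub>R y) ` (convex hull {a, b, c})"
    by (simp only: s(2) t(2) image_comp)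
  then have S: "S = (+) (v - (s * t) *\<^sub>R u) ` ((*\<^sub>R) (s * t) ` (convex hull {a, b, c}))"
    by (simp add: image_image)
  have "s * t = 1 \<or> s * t = -1"
    using s t by auto
  then show ?thesis
  proof
    assume "s * t = 1"
    then show ?thesis
      unfolding S by (simp flip: convex_hull_translation) blast
  next
    assume "s * t = -1"
    then have "S = (+) (v - (s * t) *\<^sub>R u) ` (convex hull (uminus ` {a, b, c}))"
      unfolding S uminus_convex_hull[symmetric] by (simp add: image_image)
    then show ?thesis
      by (simp flip: convex_hull_translation) blast
  qed
qed

lemma triangle_vertices_eq:
  assumes "convex hull {a, b, c} = convex hull {a', b', c'}"
    and "cross2 (b - a) (c - a) \<noteq> 0" "cross2 (b' - a') (c' - a') \<noteq> 0"
  shows "{a, b, c} = {a', b', c'}"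
  using extreme_point_of_triangle[OF assms(2)] extreme_point_of_triangle[OF assms(3)] assms(1)
  by auto

text \<open>The cross product with \<open>x - a\<close> is the weight of \<open>c\<close> in
  \<open>x\<close> times that with \<open>c - a\<close>, so the sign of the product tells the side
  of the line \<open>a b\<close>.\<close>

lemma in_triangle_side:
  assumes x: "x \<in> convex hull {a, b, c}"
  shows "0 \<le> cross2 (b - a) (x - a) * cross2 (b - a) (c - a)"
proof -
  obtain u v where uv: "0 \<le> u" "0 \<le> v" "x = a + u *\<^sub>R (b - a) + v *\<^sub>R (c - a)"
    using x unfolding convex_hull_3_alt by blast
  have "cross2 (b - a) (x - a) = v * cross2 (b - a) (c - a)"
    unfolding uv(3) cross2_def by (simp add: algebra_simps)
  then show ?thesis
    using uv by (simp add: mult.assoc)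
qed

text \<open>
  Points just beyond the midpoint of the edge lie, by local finiteness, infinitely often in one
  and the same triangle, which then contains the midpoint.
\<close>

lemma exists_triangle_across_edge:
  assumes tri: "plane_triangulation \<T>" and S: "convex hull {a, b, c} \<in> \<T>"
    and n0: "cross2 (b - a) (c - a) \<noteq> 0"
  shows "\<exists>c'. convex hull {a, b, c'} \<in> \<T> \<and> c' \<noteq> c \<and> cross2 (b - a) (c' - a) \<noteq> 0"
proof -
  define m where "m = midpoint a b"
  define x where "x n = m - inverse (real (Suc n)) *\<^sub>R (c - m)" for n
  let ?S = "convex hull {a, b, c}"
  have x_lim: "x \<longlonglongrightarrow> m"
    unfolding x_def
    using tendsto_diff[OF tendsto_const tendsto_scaleR[OF LIMSEQ_inverse_real_of_nat tendsto_const], of m "c - m"]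
    by (simp del: of_nat_Suc)
  have x_notin: "x n \<notin> ?S" for n
  proof
    assume "x n \<in> ?S"
    have "cross2 (b - a) (m - r *\<^sub>R (c - m) - a) = - r * cross2 (b - a) (c - a)" for r
      by (simp add: m_def midpoint_def cross2_def field_simps)
    then have "cross2 (b - a) (x n - a) = - inverse (real (Suc n)) * cross2 (b - a) (c - a)"
      unfolding x_def by blast
    then have "cross2 (b - a) (x n - a) * cross2 (b - a) (c - a) =
        - (inverse (real (Suc n)) * (cross2 (b - a) (c - a))\<^sup>2)"
      by (simp add: power2_eq_square)
    also have "\<dots> < 0"
      using n0 by simp
    finally show False
      using in_triangle_side[OF \<open>x n \<in> ?S\<close>] by simp
  qed
  obtain U where U: "open U" "m \<in> U" "finite {S \<in> \<T>. S \<inter> U \<noteq> {}}"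
    using plane_triangulation_locally_finite[OF tri, of m] by blast
  have "\<forall>n. \<exists>R. R \<in> \<T> \<and> x n \<in> R"
    using plane_triangulation_cover[OF tri] by blast
  then obtain R where R: "\<And>n. R n \<in> \<T>" "\<And>n. x n \<in> R n"
    by (elim choice[THEN exE]) blast
  obtain N where N: "\<And>n. n \<ge> N \<Longrightarrow> x n \<in> U"
    using x_lim U unfolding lim_explicit by blast
  have "R ` {N..} \<subseteq> {S \<in> \<T>. S \<inter> U \<noteq> {}}"
    using R N by fastforce
  then have "finite (R ` {N..})"
    using U finite_subset by blast
  then obtain k where k: "infinite {n \<in> {N..}. R n = R k}"
    using pigeonhole_infinite[of "{N..}" R] infinite_Ici by auto
  define S' where "S' = R k"
  have S'\<T>: "S' \<in> \<T>" by (simp add: S'_def R)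
  then obtain p q r where pqr: "cross2 (q - p) (r - p) \<noteq> 0" "S' = convex hull {p, q, r}"
    using plane_triangulation_simplex[OF tri] unfolding simplex_2_iff by blast
  have "m \<in> S'"
  proof -
    have "closed S'"
      by (simp add: pqr compact_imp_closed finite_imp_compact_convex_hull)
    moreover have "\<exists>\<^sub>F n in sequentially. x n \<in> S'"
    proof -
      have "\<exists>\<^sub>F n in sequentially. n \<in> {n \<in> {N..}. R n = R k}"
        using k by (simp add: cofinite_eq_sequentially[symmetric] frequently_cofinite)
      then show ?thesis
        by (rule frequently_elim1) (metis (mono_tags, lifting) R(2) S'_def mem_Collect_eq)
    qed
    ultimately show ?thesis
      using topological_tendstoD[OF x_lim, of "- S'"] by (auto simp: frequently_def open_Compl)
  qed
  have "S' \<noteq> ?S"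
    using x_notin[of k] R(2)[of k] S'_def by metis
  have m_seg: "m \<in> closed_segment a b" "closed_segment a b \<subseteq> ?S"
    by (simp add: m_def) (unfold segment_convex_hull, intro hull_mono, auto)
  have face: "(?S \<inter> S') face_of ?S" "?S \<inter> S' \<noteq> ?S" "(?S \<inter> S') face_of S'"
    using plane_triangulation_face[OF tri S S'\<T>] \<open>S' \<noteq> ?S\<close> \<open>m \<in> S'\<close> m_seg by blast+
  have ab: "a \<noteq> b" "a \<noteq> c" "b \<noteq> c"
    using n0 by (auto simp: cross2_def)
  \<comment> \<open>A face that contains an interior point of a segment contains both of its
    endpoints, so the whole edge lies in \<open>S'\<close>.\<close>
  have "m \<in> open_segment a b"
    using ab by (simp add: m_def)
  then have in_S': "a \<in> S'" "b \<in> S'"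
    using face_ofD[OF face(1), of m a b] m_seg \<open>m \<in> S'\<close> by (auto simp: hull_inc)
  \<comment> \<open>Faces of a simplex are hulls of sets of vertices. This one contains
    \<open>a\<close> and \<open>b\<close> but, being proper, not \<open>c\<close>; the intersection
    is exactly the edge.\<close>
  obtain C where C: "C \<subseteq> {a, b, c}" "?S \<inter> S' = convex hull C"
    using face(1) face_of_convex_hull_affine_independent[OF affine_independent_triangle[OF n0]] by auto
  have "a \<in> C" "b \<in> C"
  proof -
    have "y \<in> C" if "y \<in> {a, b}" for y
    proof -
      have "y extreme_point_of ?S"
        using that extreme_point_of_triangle[OF n0] by auto
      then have "y extreme_point_of convex hull C"
        using that in_S' C(2) unfolding extreme_point_of_def by (auto simp: hull_inc)
      then show ?thesis
        by (rule extreme_point_of_convex_hull)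
    qed
    then show "a \<in> C" "b \<in> C" by auto
  qed
  moreover have "c \<notin> C"
    using face(2) C calculation by (metis insert_subset subset_antisym empty_subsetI)
  ultimately have "C = {a, b}"
    using C by blast
  then have seg: "?S \<inter> S' = convex hull {a, b}"
    using C by simp
  \<comment> \<open>The same edge is also a face of \<open>S'\<close>, which makes \<open>a\<close>
    and \<open>b\<close> vertices of \<open>S'\<close> and leaves one further vertex
    \<open>c'\<close>.\<close>
  obtain C' where C': "C' \<subseteq> {p, q, r}" "?S \<inter> S' = convex hull C'"
    using face(3) face_of_convex_hull_affine_independent[OF affine_independent_triangle[OF pqr(1)]] pqr by auto
  have pqr_vert: "y \<in> {p, q, r}" if "y \<in> {a, b}" for y
  proof -
    have "y extreme_point_of convex hull {a, b}"
      using that by (auto simp: segment_convex_hull[symmetric] extreme_point_of_segment)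
    then have "y \<in> C'"
      using C' seg extreme_point_of_convex_hull by metis
    then show ?thesis using C' by blast
  qed
  have "\<exists>c'. {p, q, r} = {a, b, c'}"
    using pqr_vert[of a] pqr_vert[of b] ab by auto
  then obtain c' where c': "{p, q, r} = {a, b, c'}" by blast
  have "S' = convex hull {a, b, c'}"
    using pqr c' by simp
  moreover have "cross2 (b - a) (c' - a) \<noteq> 0"
  proof -
    have "card {p, q, r} = 3"
      using pqr(1) by (auto simp: cross2_def card_insert_if)
    then have "c' \<noteq> a" "c' \<noteq> b"
      using c' ab by (auto simp: insert_commute)
    moreover have "\<not> affine_dependent {a, b, c'}"
      using affine_independent_triangle[OF pqr(1)] c' by simp
    ultimately show ?thesis
      using ab by (simp add: cross2_nonzero_iff collinear_3_eq_affine_dependent)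
  qed
  ultimately show ?thesis
    using \<open>S' \<noteq> ?S\<close> S'\<T> by blast
qed

text \<open>The neighbour across the edge is a translate or a reflection of the given triangle. A
  nontrivial translate shares at most one vertex with it, and a reflection having both
  \<open>a\<close> and \<open>b\<close> as vertices must exchange them.\<close>

lemma reflected_triangle_in_tiling:
  assumes tiling: "parallelogram_tiling \<T>" and S: "convex hull {a, b, c} \<in> \<T>"
    and n0: "cross2 (b - a) (c - a) \<noteq> 0"
  shows "convex hull {a, b, a + b - c} \<in> \<T>"
proof -
  have "plane_triangulation \<T>"
    using tiling by (simp add: parallelogram_tiling_def)
  then obtain c' where c': "convex hull {a, b, c'} \<in> \<T>" "c' \<noteq> c" "cross2 (b - a) (c' - a) \<noteq> 0"
    using exists_triangle_across_edge[OF _ S n0] by blast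
  have dbl: "u + u = v + v \<longleftrightarrow> u = v" for u v :: "real^2"
    by (simp flip: scaleR_2)
  have nmid: "a + a \<noteq> b + c" "b + b \<noteq> a + c"
  proof -
    have "cross2 (b - a) (a + a - b - a) = 0" "cross2 (b - a) (b + b - a - a) = 0"
      by (simp_all add: cross2_def algebra_simps)
    then have "c \<noteq> a + a - b" "c \<noteq> b + b - a"
      using n0 by metis+
    then show "a + a \<noteq> b + c" "b + b \<noteq> a + c"
      by (auto simp: eq_diff_eq add.commute)
  qed
  have ab: "a \<noteq> b" "a \<noteq> c" "b \<noteq> c"
    using n0 by (auto simp: cross2_def)
  obtain z where "convex hull {a, b, c'} = convex hull {z + a, z + b, z + c} \<or>
      convex hull {a, b, c'} = convex hull {z - a, z - b, z - c}"
    using parallelogram_tiling_homothetic[OF tiling S c'(1)] by blast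
  moreover have "cross2 ((z + b) - (z + a)) ((z + c) - (z + a)) \<noteq> 0"
    "cross2 ((z - b) - (z - a)) ((z - c) - (z - a)) \<noteq> 0"
    using n0 by (simp_all add: cross2_def algebra_simps)
  ultimately have "{a, b, c'} = {z + a, z + b, z + c} \<or> {a, b, c'} = {z - a, z - b, z - c}"
    using triangle_vertices_eq c'(3) by metis
  then have "c' = a + b - c"
  proof
    assume eq: "{a, b, c'} = {z + a, z + b, z + c}"
    have "z \<noteq> 0"
      using eq ab c'(2,3) by (auto simp: doubleton_eq_iff insert_eq_iff)
    then have "a = z + b \<or> a = z + c" "b = z + a \<or> b = z + c"
      using eq by auto
    moreover have False if "a = z + b" "b = z + a"
      using that ab(1) dbl[of a b] by (metis add.assoc add.commute)
    moreover have False if "a = z + b" "b = z + c"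
      using that nmid(2) by (metis add.assoc add.commute)
    moreover have False if "a = z + c" "b = z + a"
      using that nmid(1) by (metis add.assoc add.commute)
    ultimately show ?thesis
      using ab by metis
  next
    assume eq: "{a, b, c'} = {z - a, z - b, z - c}"
    have "a \<in> {z - a, z - b, z - c}" "b \<in> {z - a, z - b, z - c}"
      unfolding eq[symmetric] by simp_all
    then have "a = z - a \<or> a = z - b \<or> a = z - c" "b = z - a \<or> b = z - b \<or> b = z - c"
      by blast+
    then have "z = a + a \<or> z = a + b \<or> z = a + c" "z = a + b \<or> z = b + b \<or> z = b + c"
      by (metis eq_diff_eq add.commute)+
    \<comment> \<open>Any other pair of choices would identify two vertices or put a vertex at the
      midpoint of the other two.\<close>
    then have "z = a + b"
      using nmid ab dbl[of a b] by auto
    then have "c' \<in> {b, a, a + b - c}" "a + b - c \<in> {a, b, c'}"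
      using eq by auto
    then show ?thesis
      using ab by (auto simp: algebra_simps)
  qed
  then show ?thesis
    using c' by simp
qed

subsection \<open>Density\<close>

text \<open>The intersection is empty or a proper face, hence of lower dimension; a convex set with
  empty interior is null. This lets areas of triangles be added.\<close>

lemma negligible_triangle_Int:
  assumes "plane_triangulation \<T>" "S \<in> \<T>" "S' \<in> \<T>" "S \<noteq> S'"
  shows "negligible (S \<inter> S')"
proof (cases "S \<inter> S' = {}")
  case False
  then have face: "(S \<inter> S') face_of S" "S \<inter> S' \<noteq> S"
    using plane_triangulation_face[OF assms] by blast+
  have S: "2 simplex S" "2 simplex S'"
    using plane_triangulation_simplex assms by blast+
  then have convex: "convex S" "convex S'"
    unfolding simplex_2_iff by (auto simp: convex_convex_hull)
  have "aff_dim (S \<inter> S') < aff_dim S"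
    using face_of_aff_dim_lt[OF convex(1) face] .
  also have "aff_dim S \<le> 2"
    using aff_dim_le_DIM[of S] by simp
  finally have "interior (S \<inter> S') = {}"
    using aff_dim_nonempty_interior[of "S \<inter> S'"] by force
  then show ?thesis
    using negligible_convex_interior convex convex_Int by blast
qed simp

lemma compact_triangle: "2 simplex S \<Longrightarrow> compact S" for S :: "(real^2) set"
  unfolding simplex_2_iff by (auto intro: finite_imp_compact_convex_hull)

lemma centered_square_eq_cbox: "centered_square l = cbox (\<chi> i. - (l / 2)) (\<chi> i. l / 2)"
proof -
  have "\<bar>t\<bar> \<le> l / 2 \<longleftrightarrow> - (l / 2) \<le> t \<and> t \<le> l / 2" for t
    by linarith
  then show ?thesis
    by (simp only: centered_square_def set_eq_iff mem_box_cart vec_lambda_beta mem_Collect_eq simp_thms)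
qed

lemma measure_centered_square: "0 \<le> l \<Longrightarrow> measure lborel (centered_square l) = l\<^sup>2"
proof -
  assume "0 \<le> l"
  then have "0 \<in> cbox (\<chi> i. - (l / 2)) (\<chi> i. l / 2 :: real^2)"
    by (simp add: mem_box_cart)
  then show ?thesis
    unfolding centered_square_eq_cbox by (subst content_cbox_cart) auto
qed

lemma locally_finite_compact:
  assumes "locally_finite_in euclidean \<A>" "compact K"
  shows "finite {S \<in> \<A>. S \<inter> K \<noteq> {}}"
proof -
  have "\<forall>x. \<exists>V. open V \<and> x \<in> V \<and> finite {U \<in> \<A>. U \<inter> V \<noteq> {}}"
    using assms(1) unfolding locally_finite_in_def by simp
  then obtain V where V: "\<And>x. open (V x)" "\<And>x. x \<in> V x" "\<And>x. finite {U \<in> \<A>. U \<inter> V x \<noteq> {}}"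
    by metis
  obtain D where D: "D \<subseteq> K" "finite D" "K \<subseteq> (\<Union>x\<in>D. V x)"
    using compactE_image[OF assms(2), of K V] V by blast
  have "{S \<in> \<A>. S \<inter> K \<noteq> {}} \<subseteq> (\<Union>x\<in>D. {U \<in> \<A>. U \<inter> V x \<noteq> {}})"
    using D(3) by fastforce
  moreover have "finite (\<Union>x\<in>D. {U \<in> \<A>. U \<inter> V x \<noteq> {}})"
    using D(2) V(3) by simp
  ultimately show ?thesis
    by (rule finite_subset)
qed

text \<open>
  The triangles meeting \<open>Q\<^sub>l\<close> cover it and lie in \<open>Q\<^bsub>l+2D\<^esub>\<close>, so their total area is between
  \<open>l\<^sup>2\<close> and \<open>(l + 2D)\<^sup>2\<close>.
\<close>

lemma triangle_density_eq:
  assumes tri: "plane_triangulation \<T>" and A: "A > 0" "\<And>S. S \<in> \<T> \<Longrightarrow> measure lborel S = A"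
    and D: "D \<ge> 0" "\<And>S x y. S \<in> \<T> \<Longrightarrow> x \<in> S \<Longrightarrow> y \<in> S \<Longrightarrow> dist x y \<le> D"
  shows "triangle_density \<T> = ereal (1 / A)"
proof -
  define N where "N l = {S \<in> \<T>. S \<inter> centered_square l \<noteq> {}}" for l
  have simplex: "2 simplex S" if "S \<in> \<T>" for S
    using plane_triangulation_simplex[OF tri that] .
  have finite: "finite (N l)" for l
    unfolding N_def
    by (rule locally_finite_compact) (use tri in \<open>auto simp: plane_triangulation_def centered_square_eq_cbox compact_cbox\<close>)
  have meas: "S \<in> lmeasurable" if "S \<in> N l" for S l
    using that simplex compact_triangle lmeasurable_compact unfolding N_def by blast
  have area: "measure lebesgue (\<Union>(N l)) = card (N l) * A" for l
  proof -
    have "measure lebesgue (\<Union>(N l)) = (\<Sum>S\<in>N l. measure lebesgue S)"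
      by (rule measure_negligible_finite_Union[OF finite meas])
        (auto simp: pairwise_def N_def intro: negligible_triangle_Int[OF tri])
    also have "\<dots> = (\<Sum>S\<in>N l. A)"
    proof (rule sum.cong)
      fix S assume S: "S \<in> N l"
      then have "compact S"
        unfolding N_def using simplex compact_triangle by blast
      then have "S \<in> sets borel"
        by (intro borel_closed compact_imp_closed)
      then show "measure lebesgue S = A"
        using A(2)[of S] S by (simp add: N_def measure_completion)
    qed simp
    finally show ?thesis by simp
  qed
  have square: "centered_square l \<in> lmeasurable" "l \<ge> 0 \<Longrightarrow> measure lebesgue (centered_square l) = l\<^sup>2" for l
    using measure_centered_square[of l] by (auto simp: centered_square_eq_cbox measure_completion)
  have union_meas: "\<Union>(N l) \<in> lmeasurable" for l
    using finite meas by (intro fmeasurable.finite_Union) auto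
  have bounds: "1 / A \<le> card (N l) / l\<^sup>2" "card (N l) / l\<^sup>2 \<le> (1 + 2 * D / l)\<^sup>2 / A" if l: "l > 0" for l
  proof -
    have "l\<^sup>2 \<le> card (N l) * A"
    proof -
      have "centered_square l \<subseteq> \<Union>(N l)"
        using plane_triangulation_cover[OF tri] unfolding N_def by blast
      then have "measure lebesgue (centered_square l) \<le> measure lebesgue (\<Union>(N l))"
        using square union_meas by (intro measure_mono_fmeasurable) auto
      then show ?thesis using square area l by simp
    qed
    then show "1 / A \<le> card (N l) / l\<^sup>2"
      using A l by (simp add: field_simps)
    have "card (N l) * A \<le> (l + 2 * D)\<^sup>2"
    proof -
      have "\<Union>(N l) \<subseteq> centered_square (l + 2 * D)"
      proof
        fix x assume "x \<in> \<Union>(N l)"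
        then obtain S y where S: "S \<in> \<T>" "x \<in> S" "y \<in> S" "y \<in> centered_square l"
          unfolding N_def by blast
        have "\<bar>x $ i\<bar> \<le> (l + 2 * D) / 2" for i
          using D(2)[OF S(1-3)] S(4) component_le_norm_cart[of "x - y" i]
          by (fastforce simp: centered_square_def dist_norm dest: spec[of _ i])
        then show "x \<in> centered_square (l + 2 * D)"
          by (simp add: centered_square_def)
      qed
      then have "measure lebesgue (\<Union>(N l)) \<le> measure lebesgue (centered_square (l + 2 * D))"
        using square union_meas by (intro measure_mono_fmeasurable) auto
      then show ?thesis using square area l D by simp
    qed
    then have "card (N l) / l\<^sup>2 \<le> (l + 2 * D)\<^sup>2 / A / l\<^sup>2"
      using A l by (simp add: field_simps)
    also have "\<dots> = (1 + 2 * D / l)\<^sup>2 / A"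
      using l by (simp add: field_simps power2_eq_square)
    finally show "card (N l) / l\<^sup>2 \<le> (1 + 2 * D / l)\<^sup>2 / A" .
  qed
  have "((\<lambda>l. card (N l) / l\<^sup>2) \<longlongrightarrow> 1 / A) at_top"
  proof (rule tendsto_sandwich)
    show "\<forall>\<^sub>F l in at_top. 1 / A \<le> card (N l) / l\<^sup>2"
      using eventually_gt_at_top[of 0] by eventually_elim (rule bounds)
    show "\<forall>\<^sub>F l in at_top. card (N l) / l\<^sup>2 \<le> (1 + 2 * D / l)\<^sup>2 / A"
      using eventually_gt_at_top[of 0] by eventually_elim (rule bounds)
    have "((\<lambda>l. (1 + 2 * D / l)\<^sup>2 / A) \<longlongrightarrow> (1 + 0)\<^sup>2 / A) at_top"
      using A by (intro tendsto_intros tendsto_divide_0[OF tendsto_const] filterlim_at_top_imp_at_infinity filterlim_ident) auto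
    then show "((\<lambda>l. (1 + 2 * D / l)\<^sup>2 / A) \<longlongrightarrow> 1 / A) at_top"
      by simp
  qed simp
  then show ?thesis
    unfolding triangle_density_def N_def
    by (intro lim_imp_Limsup) auto
qed

subsection \<open>The lower bound\<close>

text \<open>This is twice the error estimate at the midpoint, which lies in \<open>S\<close> by
  convexity, so that \<open>f\<close> takes there the mean of its values at \<open>a\<close> and
  \<open>b\<close>.\<close>

lemma pl_approximation_edge:
  assumes f: "pl_approximation \<epsilon> xy \<T> f" and S: "S \<in> \<T>" "convex S" "a \<in> S" "b \<in> S"
  shows "\<bar>f a - xy a + (f b - xy b) + xy (b - a) / 2\<bar> \<le> 2 * \<epsilon>"
proof -
  obtain h c where h: "linear h" "\<And>x. x \<in> S \<Longrightarrow> f x = h x + c"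
    using f S(1) unfolding pl_approximation_def by blast
  have "midpoint a b \<in> S"
    using S convex_contains_segment[of S] by (meson in_mono midpoint_in_closed_segment)
  then have "f (midpoint a b) = (f a + f b) / 2"
    using S h by (simp add: midpoint_def linear_scale linear_add field_simps)
  moreover have "xy (midpoint a b) = (xy a + xy b) / 2 - xy (b - a) / 4"
    by (simp add: xy_def midpoint_def field_simps)
  ultimately have "f a - xy a + (f b - xy b) + xy (b - a) / 2 = 2 * (f (midpoint a b) - xy (midpoint a b))"
    by (simp add: field_simps)
  moreover have "\<bar>f (midpoint a b) - xy (midpoint a b)\<bar> \<le> \<epsilon>"
    using f unfolding pl_approximation_def by blast
  ultimately show ?thesis by simp
qed

lemma pl_approximation_triangle:
  assumes "pl_approximation \<epsilon> xy \<T> f" "convex hull {a, b, c} \<in> \<T>"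
  shows "\<bar>f a - xy a + (f b - xy b) + xy (b - a) / 2\<bar> \<le> 2 * \<epsilon>"
    "\<bar>f b - xy b + (f c - xy c) + xy (c - b) / 2\<bar> \<le> 2 * \<epsilon>"
    "\<bar>f a - xy a + (f c - xy c) + xy (c - a) / 2\<bar> \<le> 2 * \<epsilon>"
  by (rule pl_approximation_edge[OF assms]; simp add: convex_convex_hull hull_inc)+

lemma cross2_permute:
  "cross2 (c - b) (a - b) = cross2 (b - a) (c - a)"
  "cross2 (a - b) (c - b) = - cross2 (b - a) (c - a)"
  by (simp_all add: cross2_def algebra_simps)

text \<open>
  In the parallelogram \<open>a, b, b + c - a, c\<close> two sides are parallel to \<open>b - a\<close> and two to
  \<open>c - a\<close>; summing the midpoint estimates over either pair gives the deviations of all four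
  vertices.
\<close>

lemma tiling_edge_bounds:
  assumes tiling: "parallelogram_tiling \<T>" and f: "pl_approximation \<epsilon> xy \<T> f"
    and S: "convex hull {a, b, c} \<in> \<T>" and n0: "cross2 (b - a) (c - a) \<noteq> 0"
  shows "\<bar>xy (b - a)\<bar> \<le> 8 * \<epsilon>" "\<bar>xy (b - a) - xy (c - a)\<bar> \<le> 8 * \<epsilon>"
proof -
  have dev: "\<bar>f x - xy x\<bar> \<le> \<epsilon>" for x
    using f unfolding pl_approximation_def by blast
  show "\<bar>xy (b - a)\<bar> \<le> 8 * \<epsilon>"
    using dev[of a] dev[of b] pl_approximation_triangle(1)[OF f S] by linarith
  have "convex hull {b, c, b + c - a} \<in> \<T>"
    using reflected_triangle_in_tiling[OF tiling, of b c a] S n0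
    by (simp add: insert_commute cross2_permute(1)[of c b a])
  then have "\<bar>f b - xy b + (f (b + c - a) - xy (b + c - a)) + xy (c - a) / 2\<bar> \<le> 2 * \<epsilon>"
    "\<bar>f c - xy c + (f (b + c - a) - xy (b + c - a)) + xy (b - a) / 2\<bar> \<le> 2 * \<epsilon>"
    using pl_approximation_triangle[OF f, of b c "b + c - a"] by (simp_all add: algebra_simps)
  then show "\<bar>xy (b - a) - xy (c - a)\<bar> \<le> 8 * \<epsilon>"
    using pl_approximation_triangle(1,3)[OF f S] by linarith
qed

text \<open>The edge bounds for the three rotations of the triangle supply the hypotheses of
  \<open>area_polynomial_le\<close>; by \<open>cross2_square\<close> its polynomial is four times
  the squared area.\<close>

lemma tiling_triangle_area:
  assumes eps: "\<epsilon> > 0" and tiling: "parallelogram_tiling \<T>" and f: "pl_approximation \<epsilon> xy \<T> f"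
    and S: "convex hull {a, b, c} \<in> \<T>" and n0: "cross2 (b - a) (c - a) \<noteq> 0"
  shows "measure lborel (convex hull {a, b, c}) \<le> 8 * sqrt 3 / 3 * \<epsilon>"
    and "measure lborel (convex hull {a, b, c}) = 8 * sqrt 3 / 3 * \<epsilon> \<Longrightarrow>
      \<exists>\<sigma>\<in>{1, -1}. (xy (b - a), xy (c - b), xy (c - a)) \<in>
        {(\<sigma> * (8 / 3 * \<epsilon>), \<sigma> * (8 / 3 * \<epsilon>), - \<sigma> * (16 / 3 * \<epsilon>)),
         (\<sigma> * (8 / 3 * \<epsilon>), - \<sigma> * (16 / 3 * \<epsilon>), \<sigma> * (8 / 3 * \<epsilon>)),
         (- \<sigma> * (16 / 3 * \<epsilon>), \<sigma> * (8 / 3 * \<epsilon>), \<sigma> * (8 / 3 * \<epsilon>))}"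
proof -
  let ?A = "measure lborel (convex hull {a, b, c})"
  have S': "convex hull {b, c, a} \<in> \<T>" "convex hull {c, a, b} \<in> \<T>"
    using S by (simp_all add: insert_commute)
  have n0': "cross2 (c - b) (a - b) \<noteq> 0" "cross2 (a - c) (b - c) \<noteq> 0"
    using n0 by (simp_all add: cross2_permute(1)[of c b a] cross2_permute(1)[of a c b])
  note q = tiling_edge_bounds[OF tiling f S n0] tiling_edge_bounds[OF tiling f S'(1) n0'(1)]
    tiling_edge_bounds[OF tiling f S'(2) n0'(2)]
  have comm: "xy (a - b) = xy (b - a)" "xy (a - c) = xy (c - a)" "xy (b - c) = xy (c - b)"
    by (rule xy_minus_commute)+
  note le = area_polynomial_le[OF eps, of "xy (b - a)" "xy (c - b)" "xy (c - a)", folded cross2_square]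
  have bounds: "\<bar>xy (b - a)\<bar> \<le> 8 * \<epsilon>" "\<bar>xy (c - b)\<bar> \<le> 8 * \<epsilon>" "\<bar>xy (c - a)\<bar> \<le> 8 * \<epsilon>"
    "\<bar>xy (b - a) - xy (c - b)\<bar> \<le> 8 * \<epsilon>" "\<bar>xy (c - b) - xy (c - a)\<bar> \<le> 8 * \<epsilon>" "\<bar>xy (c - a) - xy (b - a)\<bar> \<le> 8 * \<epsilon>"
    using q unfolding comm by linarith+
  have A: "(2 * ?A)\<^sup>2 = (cross2 (b - a) (c - a))\<^sup>2"
    by (simp add: content_triangle_cross2)
  have opt: "(2 * (8 * sqrt 3 / 3 * \<epsilon>))\<^sup>2 = 256 / 3 * \<epsilon>\<^sup>2"
    by (simp add: power_mult_distrib power_divide)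
  have "(2 * ?A)\<^sup>2 \<le> (2 * (8 * sqrt 3 / 3 * \<epsilon>))\<^sup>2"
    unfolding A opt by (rule le(1)[OF bounds])
  then have "2 * ?A \<le> 2 * (8 * sqrt 3 / 3 * \<epsilon>)"
    by (rule power2_le_imp_le) (use eps in simp)
  then show "?A \<le> 8 * sqrt 3 / 3 * \<epsilon>"
    by linarith
  assume area: "?A = 8 * sqrt 3 / 3 * \<epsilon>"
  have "(cross2 (b - a) (c - a))\<^sup>2 = 256 / 3 * \<epsilon>\<^sup>2"
    unfolding A[symmetric] area by (rule opt)
  from le(2)[OF bounds this]
  show "\<exists>\<sigma>\<in>{1, -1}. (xy (b - a), xy (c - b), xy (c - a)) \<in>
        {(\<sigma> * (8 / 3 * \<epsilon>), \<sigma> * (8 / 3 * \<epsilon>), - \<sigma> * (16 / 3 * \<epsilon>)),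
         (\<sigma> * (8 / 3 * \<epsilon>), - \<sigma> * (16 / 3 * \<epsilon>), \<sigma> * (8 / 3 * \<epsilon>)),
         (- \<sigma> * (16 / 3 * \<epsilon>), \<sigma> * (8 / 3 * \<epsilon>), \<sigma> * (8 / 3 * \<epsilon>))}" .
qed

text \<open>
  With \<open>x\<close> the deviation minus \<open>\<sigma>\<epsilon>/3\<close>, the midpoint estimates read \<open>\<sigma>(x a + x b) \<le> 0\<close>,
  \<open>\<sigma>(x b + x c) \<le> 0\<close> and \<open>\<sigma>(x a + x c) \<ge> 0\<close>, hence \<open>\<sigma> x b \<le> 0\<close>. Reflected triangles give the same
  at \<open>a\<close> and \<open>c\<close>, so all the inequalities are equalities.
\<close>

lemma optimal_triangle_deviation:
  assumes tiling: "parallelogram_tiling \<T>" and f: "pl_approximation \<epsilon> xy \<T> f"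
    and \<sigma>: "\<sigma> \<in> {1, -1}"
    and S: "convex hull {a, b, c} \<in> \<T>" and n0: "cross2 (b - a) (c - a) \<noteq> 0"
    and q: "xy (b - a) = \<sigma> * (8 / 3 * \<epsilon>)" "xy (c - b) = \<sigma> * (8 / 3 * \<epsilon>)" "xy (c - a) = - \<sigma> * (16 / 3 * \<epsilon>)"
  shows "\<forall>v\<in>{a, b, c}. f v - xy v = \<sigma> * (\<epsilon> / 3)"
proof -
  \<comment> \<open>The factor \<open>\<sigma>\<close> normalizes the sign, so both orientations
    lead to the same inequalities and the goal becomes \<open>x = 0\<close> at the vertices.\<close>
  define x where "x v = \<sigma> * (f v - xy v) - \<epsilon> / 3" for v
  \<comment> \<open>The middle vertex is the one opposite the edge whose \<open>xy\<close> value has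
    the exceptional sign. Adding the two estimates at the apex and subtracting the one for the
    opposite edge bounds \<open>x b\<close>.\<close>
  have apex: "x b \<le> 0" "x a + x c \<ge> 0"
    if "convex hull {a, b, c} \<in> \<T>"
      "xy (b - a) = \<sigma> * (8 / 3 * \<epsilon>)" "xy (c - b) = \<sigma> * (8 / 3 * \<epsilon>)" "xy (c - a) = - \<sigma> * (16 / 3 * \<epsilon>)"
    for a b c
  proof -
    note edges = pl_approximation_triangle[OF f that(1), unfolded that(2-4)]
    have "x b \<le> 0 \<and> x a + x c \<ge> 0"
      using \<sigma>
    proof (elim insertE emptyE)
      assume "\<sigma> = 1"
      then show ?thesis
        using edges unfolding x_def by (intro conjI; simp; linarith)
    next
      assume "\<sigma> = -1"
      then show ?thesis
        using edges unfolding x_def by (intro conjI; simp; linarith)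
    qed
    then show "x b \<le> 0" "x a + x c \<ge> 0" by simp_all
  qed
  have S': "convex hull {b, a, a + b - c} \<in> \<T>" "convex hull {b, c, b + c - a} \<in> \<T>"
    using reflected_triangle_in_tiling[OF tiling, of a b c] reflected_triangle_in_tiling[OF tiling, of b c a] S n0
    by (simp_all add: insert_commute cross2_permute(1)[of c b a])
  have q1: "xy (a - b) = \<sigma> * (8 / 3 * \<epsilon>)" "xy ((a + b - c) - a) = \<sigma> * (8 / 3 * \<epsilon>)"
    "xy ((a + b - c) - b) = - \<sigma> * (16 / 3 * \<epsilon>)"
    "xy ((b + c - a) - c) = \<sigma> * (8 / 3 * \<epsilon>)" "xy ((b + c - a) - b) = - \<sigma> * (16 / 3 * \<epsilon>)"
    using q xy_minus_commute[of a b] xy_minus_commute[of b c] xy_minus_commute[of a c] by simp_all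
  have "x b \<le> 0" "x a + x c \<ge> 0"
    by (rule apex[OF S q])+
  moreover have "x a \<le> 0" "x b + x (a + b - c) \<ge> 0"
    by (rule apex[OF S'(1) q1(1,2,3)])+
  moreover have "x c \<le> 0"
    by (rule apex[OF S'(2) q(2) q1(4,5)])
  \<comment> \<open>One further reflection makes \<open>a + b - c\<close> an apex. With
    \<open>x b + x (a + b - c) \<ge> 0\<close> this forces \<open>x b = 0\<close>.\<close>
  moreover have "x (a + b - c) \<le> 0"
  proof -
    have "convex hull {a, a + b - c, a + (a + b - c) - b} \<in> \<T>"
      using reflected_triangle_in_tiling[OF tiling, of a "a + b - c" b] S'(1) n0
      by (simp add: insert_commute cross2_def algebra_simps)
    then show ?thesis
      by (rule apex) (use q q1 xy_minus_commute[of a c] in \<open>simp_all add: algebra_simps\<close>)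
  qed
  ultimately have "x a = 0" "x b = 0" "x c = 0"
    by linarith+
  then show ?thesis
    using \<sigma> by (auto simp: x_def)
qed

text \<open>All members are congruent to \<open>S\<close>, so they share its area, and its diameter
  serves as the uniform bound in \<open>triangle_density_eq\<close>.\<close>

lemma parallelogram_tiling_density:
  assumes tiling: "parallelogram_tiling \<T>" and S: "S \<in> \<T>"
  shows "triangle_density \<T> = ereal (1 / measure lborel S)"
    and "\<And>S'. S' \<in> \<T> \<Longrightarrow> measure lborel S' = measure lborel S"
    and "measure lborel S > 0"
proof -
  have tri: "plane_triangulation \<T>"
    using tiling by (simp add: parallelogram_tiling_def)
  obtain a b c where abc: "cross2 (b - a) (c - a) \<noteq> 0" "S = convex hull {a, b, c}"
    using plane_triangulation_simplex[OF tri S] unfolding simplex_2_iff by blast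
  have homothetic: "\<exists>z. S' = convex hull {z + a, z + b, z + c} \<or> S' = convex hull {z - a, z - b, z - c}"
    if "S' \<in> \<T>" for S'
    using parallelogram_tiling_homothetic[OF tiling _ that, of a b c] S abc by blast
  have measure_eq: "measure lborel S' = measure lborel S" if "S' \<in> \<T>" for S'
    using homothetic[OF that] unfolding abc(2)
    by (auto simp: content_triangle_cross2 cross2_def algebra_simps)
  then show "\<And>S'. S' \<in> \<T> \<Longrightarrow> measure lborel S' = measure lborel S" .
  show pos: "measure lborel S > 0"
    using abc by (simp add: content_triangle_cross2)
  have bounded: "bounded S"
    using abc by (simp add: bounded_convex_hull finite_imp_bounded)
  have "dist x y \<le> diameter S" if S': "S' \<in> \<T>" "x \<in> S'" "y \<in> S'" for S' x y
  proof -
    obtain z where "S' = (\<lambda>x. z + x) ` S \<or> S' = (\<lambda>x. z - x) ` S"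
      using homothetic[OF S'(1)] unfolding abc(2) convex_hull_reflect convex_hull_translation[symmetric] by auto
    then show ?thesis
      using S' diameter_bounded_bound[OF bounded] by (auto simp: dist_norm norm_minus_commute)
  qed
  then show "triangle_density \<T> = ereal (1 / measure lborel S)"
    using diameter_ge_0[OF bounded] by (intro triangle_density_eq[OF tri pos measure_eq]) auto
qed

text \<open>One triangle determines the sign \<open>\<sigma>\<close>. As \<open>xy\<close> is even,
  translates and reflections have the same edge values, so \<open>\<sigma>\<close> is the same
  throughout the tiling.\<close>

lemma optimal_triangle_constant_deviation:
  assumes eps: "\<epsilon> > 0" and tiling: "parallelogram_tiling \<T>" and f: "pl_approximation \<epsilon> xy \<T> f"
    and area: "\<And>S. S \<in> \<T> \<Longrightarrow> measure lborel S = 8 * sqrt 3 / 3 * \<epsilon>"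
  shows "constant_deviation xy \<T> f (\<epsilon> / 3) \<or> constant_deviation xy \<T> f (- \<epsilon> / 3)"
proof -
  have tri: "plane_triangulation \<T>"
    using tiling by (simp add: parallelogram_tiling_def)
  obtain S where S: "S \<in> \<T>"
    using plane_triangulation_cover[OF tri, of 0] by blast
  obtain a b c where abc: "cross2 (b - a) (c - a) \<noteq> 0" "S = convex hull {a, b, c}"
    using plane_triangulation_simplex[OF tri S] unfolding simplex_2_iff by blast
  \<comment> \<open>The vertices are relabelled so that the apex, opposite the exceptional edge,
    comes second.\<close>
  have "\<exists>\<sigma>\<in>{1, -1}. \<exists>a b c. S = convex hull {a, b, c} \<and> cross2 (b - a) (c - a) \<noteq> 0 \<and>
      xy (b - a) = \<sigma> * (8 / 3 * \<epsilon>) \<and> xy (c - b) = \<sigma> * (8 / 3 * \<epsilon>) \<and> xy (c - a) = - \<sigma> * (16 / 3 * \<epsilon>)"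
  proof -
    obtain \<sigma> where \<sigma>: "\<sigma> \<in> {1, -1}" and pattern: "(xy (b - a), xy (c - b), xy (c - a)) \<in>
        {(\<sigma> * (8 / 3 * \<epsilon>), \<sigma> * (8 / 3 * \<epsilon>), - \<sigma> * (16 / 3 * \<epsilon>)),
         (\<sigma> * (8 / 3 * \<epsilon>), - \<sigma> * (16 / 3 * \<epsilon>), \<sigma> * (8 / 3 * \<epsilon>)),
         (- \<sigma> * (16 / 3 * \<epsilon>), \<sigma> * (8 / 3 * \<epsilon>), \<sigma> * (8 / 3 * \<epsilon>))}"
      using tiling_triangle_area(2)[OF eps tiling f S[unfolded abc(2)] abc(1) area[OF S, unfolded abc(2)]] by blast
    from pattern consider
        "xy (b - a) = \<sigma> * (8 / 3 * \<epsilon>)" "xy (c - b) = \<sigma> * (8 / 3 * \<epsilon>)" "xy (c - a) = - \<sigma> * (16 / 3 * \<epsilon>)"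
      | "xy (a - b) = \<sigma> * (8 / 3 * \<epsilon>)" "xy (c - a) = \<sigma> * (8 / 3 * \<epsilon>)" "xy (c - b) = - \<sigma> * (16 / 3 * \<epsilon>)"
      | "xy (c - a) = \<sigma> * (8 / 3 * \<epsilon>)" "xy (b - c) = \<sigma> * (8 / 3 * \<epsilon>)" "xy (b - a) = - \<sigma> * (16 / 3 * \<epsilon>)"
      unfolding xy_minus_commute[of a b] xy_minus_commute[of b c] by blast
    then show ?thesis
    proof cases
      case 1
      then show ?thesis using abc \<sigma> by blast
    next
      case 2
      moreover have "S = convex hull {b, a, c}" "cross2 (a - b) (c - b) \<noteq> 0"
        using abc by (simp_all add: insert_commute cross2_permute(2)[of a b c])
      ultimately show ?thesis using \<sigma> by blast
    next
      case 3
      moreover have "S = convex hull {a, c, b}" "cross2 (c - a) (b - a) \<noteq> 0"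
        using abc by (simp_all add: insert_commute cross2_def algebra_simps)
      ultimately show ?thesis using \<sigma> by blast
    qed
  qed
  then obtain \<sigma> a b c where \<sigma>: "\<sigma> \<in> {1, -1}" and abc: "S = convex hull {a, b, c}" "cross2 (b - a) (c - a) \<noteq> 0"
    and q: "xy (b - a) = \<sigma> * (8 / 3 * \<epsilon>)" "xy (c - b) = \<sigma> * (8 / 3 * \<epsilon>)" "xy (c - a) = - \<sigma> * (16 / 3 * \<epsilon>)"
    by blast
  have comm: "xy (a - b) = xy (b - a)" "xy (a - c) = xy (c - a)" "xy (b - c) = xy (c - b)"
    by (rule xy_minus_commute)+
  have "f v - xy v = \<sigma> * (\<epsilon> / 3)" if S': "S' \<in> \<T>" "v extreme_point_of S'" for S' v
  proof -
    obtain z where "S' = convex hull {z + a, z + b, z + c} \<or> S' = convex hull {z - a, z - b, z - c}"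
      using parallelogram_tiling_homothetic[OF tiling S[unfolded abc(1)] S'(1)] by blast
    then obtain p q' r where pqr: "S' = convex hull {p, q', r}"
      "xy (q' - p) = xy (b - a)" "xy (r - q') = xy (c - b)" "xy (r - p) = xy (c - a)"
      "cross2 (q' - p) (r - p) = cross2 (b - a) (c - a)"
    proof
      assume "S' = convex hull {z + a, z + b, z + c}"
      then show ?thesis by (rule that) simp_all
    next
      assume "S' = convex hull {z - a, z - b, z - c}"
      then show ?thesis
        by (rule that) (simp_all add: comm cross2_def algebra_simps)
    qed
    then show ?thesis
      using optimal_triangle_deviation[OF tiling f \<sigma>, of p q' r] S' q abc(2)
        extreme_point_of_triangle[of q' p r v] by auto
  qed
  then have "constant_deviation xy \<T> f (\<sigma> * (\<epsilon> / 3))"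
    unfolding constant_deviation_def triangulation_vertices_def by blast
  then show ?thesis
    using \<sigma> by auto
qed

subsection \<open>Lattice tilings and interpolation\<close>

text \<open>On each interval between consecutive integers this is the chord of the parabola
  \<open>t^2\<close>.\<close>

definition square_interpolant :: "real \<Rightarrow> real" where
  "square_interpolant t = (2 * real_of_int \<lfloor>t\<rfloor> + 1) * t - real_of_int \<lfloor>t\<rfloor> * (real_of_int \<lfloor>t\<rfloor> + 1)"

text \<open>At the right end the floor already jumps, but adjacent chords agree there. The closed
  interval is what closed triangles require.\<close>

lemma square_interpolant_interval:
  fixes n :: int and t :: real
  assumes "n \<le> t" "t \<le> n + 1"
  shows "square_interpolant t = (2 * real_of_int n + 1) * t - n * (real_of_int n + 1)"
proof (cases "t = n + 1")
  case True
  then have "\<lfloor>t\<rfloor> = n + 1" by linarith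
  then show ?thesis
    unfolding square_interpolant_def by (simp add: True algebra_simps)
next
  case False
  then have "\<lfloor>t\<rfloor> = n" using assms by linarith
  then show ?thesis
    by (simp add: square_interpolant_def)
qed

lemma square_interpolant_of_int: "square_interpolant (of_int n) = (of_int n)\<^sup>2"
  by (simp add: square_interpolant_def power2_eq_square algebra_simps)

lemma square_interpolant_diff: "square_interpolant t - t\<^sup>2 = frac t * (1 - frac t)"
  by (simp add: square_interpolant_def frac_def power2_eq_square algebra_simps)

lemma continuous_on_square_interpolant: "continuous_on UNIV square_interpolant"
proof -
  have "isCont square_interpolant t" for t
  proof -
    define m where "m = \<lfloor>t\<rfloor>"
    \<comment> \<open>Near \<open>m\<close> the two chords, of slopes \<open>2 m - 1\<close> and
      \<open>2 m + 1\<close>, combine into one expression with an absolute value.\<close>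
    define h where "h s = 2 * real_of_int m * s - (real_of_int m)\<^sup>2 + \<bar>s - real_of_int m\<bar>" for s
    have eq: "square_interpolant s = h s" if "s \<in> {real_of_int m - 1<..<real_of_int m + 1}" for s
    proof (cases "s \<ge> m")
      case True
      then show ?thesis
        using square_interpolant_interval[of m s] that by (simp add: h_def power2_eq_square algebra_simps)
    next
      case False
      then show ?thesis
        using square_interpolant_interval[of "m - 1" s] that by (simp add: h_def power2_eq_square algebra_simps)
    qed
    have "t \<in> {real_of_int m - 1<..<real_of_int m + 1}"
      unfolding m_def by simp linarith
    then have "\<forall>\<^sub>F s in nhds t. square_interpolant s = h s"
      using eq eventually_nhds_in_open[of "{real_of_int m - 1<..<real_of_int m + 1}" t]
      by (auto elim: eventually_mono)
    moreover have "isCont h t"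
      unfolding h_def by (intro continuous_intros)
    ultimately show ?thesis
      by (simp add: isCont_cong)
  qed
  then show ?thesis
    by (simp add: continuous_at_imp_continuous_on)
qed

text \<open>The lower bound uses only \<open>0 \<le> \<psi> \<le> 1/4\<close>. For the upper one,
  the combination equals \<open>w - w^2\<close> minus a nonnegative product, where \<open>w\<close>
  is the sum of the fractional parts or of their complements.\<close>

lemma square_interpolant_combination_bounds:
  defines "\<psi> \<equiv> \<lambda>t. square_interpolant t - t\<^sup>2"
  shows "- (1 / 2) \<le> 2 * \<psi> (s + t) - \<psi> s - \<psi> t" "2 * \<psi> (s + t) - \<psi> s - \<psi> t \<le> 1 / 4"
proof -
  have \<psi>: "\<psi> t = frac t * (1 - frac t)" for t
    by (simp add: \<psi>_def square_interpolant_diff)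
  have quarter: "w - w\<^sup>2 \<le> 1 / 4" for w :: real
    using zero_le_power2[of "w - 1 / 2"] by (simp add: power2_eq_square algebra_simps)
  have "0 \<le> \<psi> t" "\<psi> t \<le> 1 / 4" for t
    using quarter[of "frac t"] frac_lt_1[of t] mult_nonneg_nonneg[of "frac t" "1 - frac t"]
    by (simp_all add: \<psi> power2_eq_square algebra_simps)
  from this[of s] this[of t] this[of "s + t"]
  show "- (1 / 2) \<le> 2 * \<psi> (s + t) - \<psi> s - \<psi> t"
    by linarith
  define a b where "a = frac s" and "b = frac t"
  have ab: "0 \<le> a" "0 \<le> b" "a < 1" "b < 1"
    by (simp_all add: a_def b_def frac_lt_1)
  show "2 * \<psi> (s + t) - \<psi> s - \<psi> t \<le> 1 / 4"
  proof (cases "a + b < 1")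
    case True
    then have "2 * \<psi> (s + t) - \<psi> s - \<psi> t = (a + b) - (a + b)\<^sup>2 - 2 * (a * b)"
      by (simp add: \<psi> frac_add a_def b_def power2_eq_square algebra_simps)
    then show ?thesis
      using quarter[of "a + b"] mult_nonneg_nonneg[OF ab(1,2)] by linarith
  next
    case False
    \<comment> \<open>When the fractional parts carry, passing to complements restores the previous
      formula, since \<open>\<psi>\<close> is unchanged by replacing \<open>frac t\<close> with
      \<open>1 - frac t\<close>.\<close>
    define u v where "u = 1 - a" and "v = 1 - b"
    have "2 * \<psi> (s + t) - \<psi> s - \<psi> t = (u + v) - (u + v)\<^sup>2 - 2 * (u * v)"
      using False by (simp add: \<psi> frac_add a_def b_def u_def v_def power2_eq_square algebra_simps)
    moreover have "0 \<le> u * v"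
      using ab by (simp add: u_def v_def)
    ultimately show ?thesis
      using quarter[of "u + v"] by linarith
  qed
qed

text \<open>An integer unit strip cuts a set inside another such strip in the whole set, in its part
  on a supporting hyperplane, or not at all.\<close>

lemma unit_strip_face:
  fixes l :: "'a::euclidean_space \<Rightarrow> real" and m n :: int
  assumes l: "linear l" and S: "convex S" "\<And>x. x \<in> S \<Longrightarrow> m \<le> l x \<and> l x \<le> m + 1"
  shows "(S \<inter> {x. n \<le> l x \<and> l x \<le> n + 1}) face_of S"
proof -
  have l_inner: "l x = adjoint l 1 \<bullet> x" for x
    using adjoint_works[OF l, of x 1] by (simp add: inner_commute)
  consider "n = m" | "n = m + 1" | "n + 1 = m" | "n > m + 1" | "n + 1 < m"
    by linarith
  then show ?thesis
  proof cases
    case 1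
    then have "S \<inter> {x. n \<le> l x \<and> l x \<le> n + 1} = S" using S(2) by auto
    then show ?thesis by (simp add: S(1) face_of_refl)
  next
    case 2
    then have "S \<inter> {x. n \<le> l x \<and> l x \<le> n + 1} = S \<inter> {x. adjoint l 1 \<bullet> x = m + 1}"
      using S(2) by (fastforce simp flip: l_inner)
    then show ?thesis
      using face_of_Int_supporting_hyperplane_le[of S "adjoint l 1" "m + 1"] S by (simp flip: l_inner)
  next
    case 3
    then have "S \<inter> {x. n \<le> l x \<and> l x \<le> n + 1} = S \<inter> {x. adjoint l 1 \<bullet> x = m}"
      using S(2) by (fastforce simp flip: l_inner)
    then show ?thesis
      using face_of_Int_supporting_hyperplane_ge[of S m "adjoint l 1"] S by (simp flip: l_inner)
  next
    case 4
    then have "real_of_int n > m + 1" by linarith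
    then have "S \<inter> {x. n \<le> l x \<and> l x \<le> n + 1} = {}" using S(2) by fastforce
    then show ?thesis by simp
  next
    case 5
    then have "real_of_int n + 1 < m" by linarith
    then have "S \<inter> {x. n \<le> l x \<and> l x \<le> n + 1} = {}" using S(2) by fastforce
    then show ?thesis by simp
  qed
qed

section \<open>The triangulation of the plane by lattice triangles\<close>

locale plane_basis =
  fixes e g :: "real^2"
  assumes cross2_basis: "cross2 e g \<noteq> 0"
begin

text \<open>Coordinates with respect to the basis \<open>e\<close>, \<open>g\<close>, written by
  Cramer's rule.\<close>

definition fst_coord :: "real^2 \<Rightarrow> real" where
  "fst_coord x = cross2 x g / cross2 e g"

definition snd_coord :: "real^2 \<Rightarrow> real" where
  "snd_coord x = cross2 e x / cross2 e g"

lemma linear_coords: "linear fst_coord" "linear snd_coord"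
  by (rule linearI; simp add: fst_coord_def snd_coord_def cross2_def algebra_simps add_divide_distrib diff_divide_distrib)+

lemma coords_add:
  "fst_coord (x + y) = fst_coord x + fst_coord y" "snd_coord (x + y) = snd_coord x + snd_coord y"
  by (simp_all add: linear_coords linear_add)

lemma coords_diff:
  "fst_coord (x - y) = fst_coord x - fst_coord y" "snd_coord (x - y) = snd_coord x - snd_coord y"
  by (simp_all add: linear_coords linear_diff)

lemma coords_scaleR:
  "fst_coord (r *\<^sub>R x) = r * fst_coord x" "snd_coord (r *\<^sub>R x) = r * snd_coord x"
  by (simp_all add: linear_coords linear_scale)

lemma coords_basis:
  "fst_coord 0 = 0" "snd_coord 0 = 0" "fst_coord e = 1" "snd_coord e = 0" "fst_coord g = 0" "snd_coord g = 1"
  using cross2_basis by (simp_all add: fst_coord_def snd_coord_def cross2_def)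

lemmas coords_simps = coords_add coords_diff coords_scaleR coords_basis

lemma coords_expansion: "fst_coord x *\<^sub>R e + snd_coord x *\<^sub>R g = x"
proof -
  have "cross2 x g * e $ i + cross2 e x * g $ i = cross2 e g * x $ i" for i
    using exhaust_2[of i] by (auto simp: cross2_def algebra_simps)
  then show ?thesis
    using cross2_basis by (simp add: vec_eq_iff fst_coord_def snd_coord_def field_simps)
qed

lemma coords_eqI: "fst_coord x = fst_coord y \<Longrightarrow> snd_coord x = snd_coord y \<Longrightarrow> x = y"
  by (metis coords_expansion)

definition lattice_point :: "int \<Rightarrow> int \<Rightarrow> real^2" where
  "lattice_point i j = of_int i *\<^sub>R e + of_int j *\<^sub>R g"

lemma coords_lattice_point: "fst_coord (lattice_point i j) = i" "snd_coord (lattice_point i j) = j"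
  by (simp_all add: lattice_point_def coords_simps)

lemma lattice_point_diff: "lattice_point m n - lattice_point i j = lattice_point (m - i) (n - j)"
  by (simp add: lattice_point_def algebra_simps)

text \<open>
  The lattice triangles are cut out by three families of strips; those with \<open>k = i + j\<close> are
  translates of \<open>conv {0, e, g}\<close>, those with \<open>k = i + j + 1\<close> of its reflection, and all other
  combinations of strips meet in at most a vertex.
\<close>

definition cell :: "int \<Rightarrow> int \<Rightarrow> int \<Rightarrow> (real^2) set" where
  "cell i j k = {x. i \<le> fst_coord x \<and> fst_coord x \<le> i + 1} \<inter> {x. j \<le> snd_coord x \<and> snd_coord x \<le> j + 1}
     \<inter> {x. k \<le> fst_coord x + snd_coord x \<and> fst_coord x + snd_coord x \<le> k + 1}"

definition lattice_tiling :: "(real^2) set set" where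
  "lattice_tiling = (\<Union>i j. {cell i j (i + j), cell i j (i + j + 1)})"

lemma mem_cell: "x \<in> cell i j k \<longleftrightarrow> i \<le> fst_coord x \<and> fst_coord x \<le> i + 1 \<and> j \<le> snd_coord x \<and> snd_coord x \<le> j + 1
     \<and> k \<le> fst_coord x + snd_coord x \<and> fst_coord x + snd_coord x \<le> k + 1"
  by (auto simp: cell_def)

lemma cell_lower_eq: "cell i j (i + j) = convex hull {lattice_point i j, lattice_point (i + 1) j, lattice_point i (j + 1)}"
  (is "_ = convex hull {?p, ?q, ?r}")
proof -
  have "x \<in> cell i j (i + j) \<longleftrightarrow> (\<exists>u v. x = ?p + u *\<^sub>R (?q - ?p) + v *\<^sub>R (?r - ?p) \<and> 0 \<le> u \<and> 0 \<le> v \<and> u + v \<le> 1)" for x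
  proof
    assume x: "x \<in> cell i j (i + j)"
    have "x = ?p + (fst_coord x - i) *\<^sub>R (?q - ?p) + (snd_coord x - j) *\<^sub>R (?r - ?p)"
      by (rule coords_eqI) (simp_all add: coords_simps coords_lattice_point)
    then show "\<exists>u v. x = ?p + u *\<^sub>R (?q - ?p) + v *\<^sub>R (?r - ?p) \<and> 0 \<le> u \<and> 0 \<le> v \<and> u + v \<le> 1"
      using x by (intro exI[of _ "fst_coord x - i"] exI[of _ "snd_coord x - j"]) (simp add: mem_cell)
  next
    assume "\<exists>u v. x = ?p + u *\<^sub>R (?q - ?p) + v *\<^sub>R (?r - ?p) \<and> 0 \<le> u \<and> 0 \<le> v \<and> u + v \<le> 1"
    then show "x \<in> cell i j (i + j)"
      by (auto simp: mem_cell coords_simps coords_lattice_point)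
  qed
  then show ?thesis
    unfolding convex_hull_3_alt by blast
qed

lemma cell_translate: "(+) (lattice_point m n) ` cell i j k = cell (i + m) (j + n) (k + m + n)"
proof -
  have "x \<in> (+) (lattice_point m n) ` cell i j k \<longleftrightarrow> x - lattice_point m n \<in> cell i j k" for x
    by (metis (no_types, opaque_lifting) add_diff_cancel_left' diff_add_cancel add.commute image_iff)
  then show ?thesis
    by (auto simp: set_eq_iff mem_cell coords_simps coords_lattice_point)
qed

lemma cell_reflect: "(\<lambda>x. lattice_point m n - x) ` cell i j k = cell (m - i - 1) (n - j - 1) (m + n - k - 1)"
proof -
  have "x \<in> (\<lambda>x. lattice_point m n - x) ` cell i j k \<longleftrightarrow> lattice_point m n - x \<in> cell i j k" for x
    by (metis (no_types, opaque_lifting) diff_diff_eq2 add_diff_cancel_left' image_iff)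
  then show ?thesis
    by (auto simp: set_eq_iff mem_cell coords_simps coords_lattice_point)
qed

lemma cell_upper_eq: "cell i j (i + j + 1) =
    convex hull {lattice_point (i + 1) (j + 1), lattice_point i (j + 1), lattice_point (i + 1) j}"
proof -
  \<comment> \<open>The upper triangle is the point reflection of the lower one in the centre of
    their parallelogram, which is half of this lattice point.\<close>
  have "cell i j (i + j + 1) = (\<lambda>x. lattice_point (2 * i + 1) (2 * j + 1) - x) ` cell i j (i + j)"
    by (simp add: cell_reflect algebra_simps)
  also have "\<dots> = convex hull ((\<lambda>x. lattice_point (2 * i + 1) (2 * j + 1) - x) `
      {lattice_point i j, lattice_point (i + 1) j, lattice_point i (j + 1)})"
    unfolding cell_lower_eq by (rule convex_hull_reflect)
  also have "(\<lambda>x. lattice_point (2 * i + 1) (2 * j + 1) - x) `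
      {lattice_point i j, lattice_point (i + 1) j, lattice_point i (j + 1)} =
      {lattice_point (i + 1) (j + 1), lattice_point i (j + 1), lattice_point (i + 1) j}"
    by (simp add: lattice_point_diff algebra_simps)
  finally show ?thesis .
qed

lemma cross2_lattice_triangles:
  "cross2 (lattice_point (i + 1) j - lattice_point i j) (lattice_point i (j + 1) - lattice_point i j) = cross2 e g"
  "cross2 (lattice_point i (j + 1) - lattice_point (i + 1) (j + 1))
     (lattice_point (i + 1) j - lattice_point (i + 1) (j + 1)) = cross2 e g"
  by (simp_all add: lattice_point_def cross2_def algebra_simps)

lemma cell_in_lattice_tiling: "k = i + j \<or> k = i + j + 1 \<Longrightarrow> cell i j k \<in> lattice_tiling"
  unfolding lattice_tiling_def by blast

lemma lattice_tiling_cases: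
  assumes "S \<in> lattice_tiling"
  obtains i j k where "k = i + j \<or> k = i + j + 1" "S = cell i j k"
  using assms unfolding lattice_tiling_def by blast

lemma lattice_tiling_simplex:
  assumes "S \<in> lattice_tiling"
  shows "2 simplex S"
proof -
  have "2 simplex cell i j (i + j)" "2 simplex cell i j (i + j + 1)" for i j
    unfolding simplex_2_iff cell_lower_eq cell_upper_eq
    by (intro exI conjI, rule cross2_lattice_triangles[THEN ssubst], rule cross2_basis, rule refl)+
  then show ?thesis
    using assms unfolding lattice_tiling_def by blast
qed

text \<open>A lattice triangle contains three of the four corners of its parallelogram, and testing
  the inclusion on them fixes all indices. This makes intersections of distinct members proper
  faces.\<close>

lemma cell_subset_imp_eq:
  assumes sub: "cell i j k \<subseteq> cell i' j' k'" and k: "k = i + j \<or> k = i + j + 1"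
  shows "i = i' \<and> j = j' \<and> k = k'"
proof -
  have mem: "lattice_point m n \<in> cell i j k \<longleftrightarrow> i \<le> m \<and> m \<le> i + 1 \<and> j \<le> n \<and> n \<le> j + 1 \<and> k \<le> m + n \<and> m + n \<le> k + 1"
    for m n i j k
    by (simp add: mem_cell coords_lattice_point flip: of_int_add) (metis of_int_1 of_int_add of_int_le_iff)
  have "lattice_point m n \<in> cell i j k \<Longrightarrow> lattice_point m n \<in> cell i' j' k'" for m n
    using sub by blast
  from this[of i j] this[of "i + 1" j] this[of i "j + 1"] this[of "i + 1" "j + 1"]
  show ?thesis
    using k unfolding mem by presburger
qed

lemma cell_convex: "convex (cell i j k)"
proof -
  have "linear (\<lambda>x. fst_coord x + snd_coord x)"
    using linear_coords by (rule linear_compose_add)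
  then have "convex (fst_coord -` {i..i+1} \<inter> snd_coord -` {j..j+1} \<inter> (\<lambda>x. fst_coord x + snd_coord x) -` {k..k+1})"
    using linear_coords by (intro convex_Int convex_linear_vimage convex_real_interval) auto
  also have "fst_coord -` {i..i+1} \<inter> snd_coord -` {j..j+1} \<inter> (\<lambda>x. fst_coord x + snd_coord x) -` {k..k+1} = cell i j k"
    by (auto simp: mem_cell)
  finally show ?thesis .
qed

lemma cell_Int_face: "(cell i j k \<inter> cell i' j' k') face_of cell i j k"
proof -
  have lin: "linear (\<lambda>x. fst_coord x + snd_coord x)"
    using linear_coords by (rule linear_compose_add)
  let ?S = "cell i j k"
  have "(?S \<inter> {x. i' \<le> fst_coord x \<and> fst_coord x \<le> i' + 1}) \<inter> (?S \<inter> {x. j' \<le> snd_coord x \<and> snd_coord x \<le> j' + 1})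
     \<inter> (?S \<inter> {x. k' \<le> fst_coord x + snd_coord x \<and> fst_coord x + snd_coord x \<le> k' + 1}) face_of ?S"
    by (intro face_of_Int unit_strip_face[OF linear_coords(1) cell_convex, of i j k i i']
        unit_strip_face[OF linear_coords(2) cell_convex, of i j k j j'] unit_strip_face[OF lin cell_convex, of i j k k k'])
      (auto simp: mem_cell)
  also have "(?S \<inter> {x. i' \<le> fst_coord x \<and> fst_coord x \<le> i' + 1}) \<inter> (?S \<inter> {x. j' \<le> snd_coord x \<and> snd_coord x \<le> j' + 1})
     \<inter> (?S \<inter> {x. k' \<le> fst_coord x + snd_coord x \<and> fst_coord x + snd_coord x \<le> k' + 1}) = ?S \<inter> cell i' j' k'"
    by (auto simp: mem_cell)
  finally show ?thesis .
qed

lemma lattice_tiling_cover: "\<exists>S\<in>lattice_tiling. x \<in> S"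
proof -
  let ?i = "\<lfloor>fst_coord x\<rfloor>" and ?j = "\<lfloor>snd_coord x\<rfloor>" and ?k = "\<lfloor>fst_coord x + snd_coord x\<rfloor>"
  \<comment> \<open>The floor of a sum is the sum of the floors or one more, which are exactly the
    two admissible values of \<open>k\<close>.\<close>
  have "cell ?i ?j ?k \<in> lattice_tiling"
    by (rule cell_in_lattice_tiling) linarith
  moreover have "x \<in> cell ?i ?j ?k"
    unfolding mem_cell by linarith
  ultimately show ?thesis by blast
qed

lemma continuous_coords: "continuous_on A fst_coord" "continuous_on A snd_coord"
  using linear_coords by (simp_all add: linear_continuous_on linear_conv_bounded_linear)

lemma lattice_tiling_locally_finite: "locally_finite_in euclidean lattice_tiling"
  unfolding locally_finite_in_def
proof (intro conjI ballI)
  fix x :: "real^2"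
  define U where "U = fst_coord -` ball (fst_coord x) 1 \<inter> snd_coord -` ball (snd_coord x) 1"
  have "open U"
    unfolding U_def using continuous_coords by (intro open_Int open_vimage) auto
  define I J where "I = {\<lfloor>fst_coord x\<rfloor> - 2..\<lfloor>fst_coord x\<rfloor> + 2}" and "J = {\<lfloor>snd_coord x\<rfloor> - 2..\<lfloor>snd_coord x\<rfloor> + 2}"
  have "{S \<in> lattice_tiling. S \<inter> U \<noteq> {}} \<subseteq> (\<Union>i\<in>I. \<Union>j\<in>J. {cell i j (i + j), cell i j (i + j + 1)})"
  proof
    fix S assume "S \<in> {S \<in> lattice_tiling. S \<inter> U \<noteq> {}}"
    then obtain y where S: "S \<in> lattice_tiling" "y \<in> S" "y \<in> U" by blast
    obtain i j k where ijk: "k = i + j \<or> k = i + j + 1" "S = cell i j k"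
      using S(1) by (rule lattice_tiling_cases)
    have "\<bar>fst_coord x - fst_coord y\<bar> < 1" "\<bar>snd_coord x - snd_coord y\<bar> < 1"
      using S(3) by (auto simp: U_def dist_real_def)
    moreover have "i \<le> fst_coord y" "fst_coord y \<le> i + 1" "j \<le> snd_coord y" "snd_coord y \<le> j + 1"
      using S(2) by (auto simp: ijk mem_cell)
    ultimately have "i \<in> I" "j \<in> J"
      unfolding I_def J_def atLeastAtMost_iff by linarith+
    then show "S \<in> (\<Union>i\<in>I. \<Union>j\<in>J. {cell i j (i + j), cell i j (i + j + 1)})"
      using ijk by blast
  qed
  then have "finite {S \<in> lattice_tiling. S \<inter> U \<noteq> {}}"
    by (rule finite_subset) (simp add: I_def J_def)
  moreover have "x \<in> U"
    by (simp add: U_def)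
  ultimately show "\<exists>V. openin euclidean V \<and> x \<in> V \<and> finite {U \<in> lattice_tiling. U \<inter> V \<noteq> {}}"
    using \<open>open U\<close> by auto
qed simp

lemma plane_triangulation_lattice_tiling: "plane_triangulation lattice_tiling"
  unfolding plane_triangulation_def
proof (intro conjI ballI impI)
  show "\<Union>lattice_tiling = UNIV"
    using lattice_tiling_cover by blast
  have face: "(S \<inter> S') face_of S \<and> S \<inter> S' \<noteq> S"
    if S: "S \<in> lattice_tiling" "S' \<in> lattice_tiling" "S \<noteq> S'" for S S'
  proof -
    obtain i j k where ijk: "k = i + j \<or> k = i + j + 1" "S = cell i j k"
      using S(1) by (rule lattice_tiling_cases)
    obtain i' j' k' where ijk': "S' = cell i' j' k'"
      using S(2) by (rule lattice_tiling_cases)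
    have "S \<inter> S' \<noteq> S"
      using cell_subset_imp_eq[of i j k i' j' k'] ijk ijk' S(3) by blast
    then show ?thesis
      using cell_Int_face ijk ijk' by blast
  qed
  fix S S' assume S: "S \<in> lattice_tiling" "S' \<in> lattice_tiling" "S \<noteq> S'"
  show "S \<inter> S' = {} \<or> (S \<inter> S') face_of S \<and> S \<inter> S' \<noteq> S \<and> (S \<inter> S') face_of S' \<and> S \<inter> S' \<noteq> S'"
    using face[OF S] face[OF S(2,1)] S(3) by (metis Int_commute)
qed (use lattice_tiling_simplex lattice_tiling_locally_finite in auto)

section \<open>The lattice tiling as a parallelogram tiling\<close>

definition strip_box :: "int \<Rightarrow> int \<Rightarrow> (real^2) set" where
  "strip_box i j = {x. i \<le> fst_coord x \<and> fst_coord x \<le> i + 1 \<and> j \<le> snd_coord x \<and> snd_coord x \<le> j + 1}"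

lemma cell_Un: "cell i j (i + j) \<union> cell i j (i + j + 1) = strip_box i j"
  by (auto simp: mem_cell strip_box_def)

text \<open>Distinct integer strips meet at most in the line where \<open>l\<close> equals the
  larger of the two indices.\<close>

lemma interior_strip_Int:
  fixes l :: "real^2 \<Rightarrow> real" and m n :: int
  assumes "linear l" "l v \<noteq> 0" "m \<noteq> n"
  shows "interior ({x. of_int m \<le> l x \<and> l x \<le> of_int m + 1} \<inter> {x. of_int n \<le> l x \<and> l x \<le> of_int n + 1}) = {}"
    (is "interior (?A \<inter> ?B) = {}")
proof -
  have l_inner: "l x = adjoint l 1 \<bullet> x" for x
    using adjoint_works[OF assms(1), of x 1] by (simp add: inner_commute)
  have "?A \<inter> ?B \<subseteq> {x. adjoint l 1 \<bullet> x = max m n}"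
  proof
    fix x assume "x \<in> ?A \<inter> ?B"
    moreover have "m + 1 \<le> n \<or> n + 1 \<le> m" using assms(3) by linarith
    then have "real_of_int m + 1 \<le> n \<or> real_of_int n + 1 \<le> m" by linarith
    ultimately show "x \<in> {x. adjoint l 1 \<bullet> x = max m n}"
      by (auto simp flip: l_inner)
  qed
  moreover have "adjoint l 1 \<noteq> 0"
    using assms(2) l_inner[of v] by auto
  ultimately show ?thesis
    using interior_mono[of "?A \<inter> ?B" "{x. adjoint l 1 \<bullet> x = max m n}"] interior_hyperplane[of "adjoint l 1"] by simp
qed

lemma interior_strip_box_Int:
  assumes "(i, j) \<noteq> (i', j')"
  shows "interior (strip_box i j) \<inter> interior (strip_box i' j') = {}"
proof -
  have "interior (strip_box i j \<inter> strip_box i' j') = {}"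
  proof (cases "i = i'")
    case False
    have "strip_box i j \<inter> strip_box i' j' \<subseteq>
        {x. i \<le> fst_coord x \<and> fst_coord x \<le> i + 1} \<inter> {x. i' \<le> fst_coord x \<and> fst_coord x \<le> i' + 1}"
      by (auto simp: strip_box_def)
    from interior_mono[OF this] interior_strip_Int[OF linear_coords(1) _ False, of e]
    show ?thesis
      by (simp add: coords_basis) blast
  next
    case True
    then have "j \<noteq> j'" using assms by simp
    have "strip_box i j \<inter> strip_box i' j' \<subseteq>
        {x. j \<le> snd_coord x \<and> snd_coord x \<le> j + 1} \<inter> {x. j' \<le> snd_coord x \<and> snd_coord x \<le> j' + 1}"
      by (auto simp: strip_box_def)
    from interior_mono[OF this] interior_strip_Int[OF linear_coords(2) _ \<open>j \<noteq> j'\<close>, of g]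
    show ?thesis
      by (simp add: coords_basis) blast
  qed
  then show ?thesis by simp
qed

lemma parallelogram_strip_box: "parallelogram (strip_box 0 0)"
proof -
  let ?H = "convex hull {0, 0 + e, 0 + g, 0 + e + g}"
  have "strip_box 0 0 \<subseteq> ?H"
  proof -
    have "cell 0 0 0 \<subseteq> ?H"
      using cell_lower_eq[of 0 0] by (simp add: lattice_point_def hull_mono)
    moreover have "cell 0 0 1 \<subseteq> ?H"
      using cell_upper_eq[of 0 0] by (simp add: lattice_point_def hull_mono)
    moreover have "strip_box 0 0 = cell 0 0 0 \<union> cell 0 0 1"
      using cell_Un[of 0 0] by simp
    ultimately show ?thesis
      by blast
  qed
  moreover have "?H \<subseteq> strip_box 0 0"
  proof (rule hull_minimal)
    have "convex (fst_coord -` {0..1} \<inter> snd_coord -` {0..1})"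
      using linear_coords by (intro convex_Int convex_linear_vimage convex_real_interval)
    then show "convex (strip_box 0 0)"
      by (simp add: strip_box_def vimage_def Collect_conj_eq[symmetric] conj_assoc)
  qed (simp add: strip_box_def coords_simps)
  moreover have "e \<noteq> g \<and> independent {e, g}"
  proof -
    have eg: "e \<noteq> g" using cross2_basis by (auto simp: cross2_def)
    have "independent {e, g}"
    proof (rule independent_if_scalars_zero)
      fix f :: "real^2 \<Rightarrow> real" and x
      assume f: "(\<Sum>x\<in>{e, g}. f x *\<^sub>R x) = 0" and x: "x \<in> {e, g}"
      have "fst_coord (f e *\<^sub>R e + f g *\<^sub>R g) = 0" "snd_coord (f e *\<^sub>R e + f g *\<^sub>R g) = 0"
        using f eg by (simp_all add: coords_basis)
      then show "f x = 0"
        using x by (auto simp: coords_simps)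
    qed simp
    then show ?thesis using eg by simp
  qed
  ultimately show ?thesis
    unfolding parallelogram_def by blast
qed

lemma parallelogram_tiling_lattice_tiling: "parallelogram_tiling lattice_tiling"
proof -
  \<comment> \<open>The witnesses are \<open>cell 0 0 0\<close> for \<open>T\<close>,
    \<open>cell 0 0 1\<close> for \<open>T'\<close> with offset \<open>lattice_point 1 1\<close>,
    and the full lattice for \<open>V\<close>.\<close>
  define V where "V = range (case_prod lattice_point)"
  have lower: "(+) (lattice_point i j) ` cell 0 0 0 = cell i j (i + j)"
    and upper: "(+) (lattice_point i j) ` cell 0 0 1 = cell i j (i + j + 1)" for i j
    using cell_translate[of i j 0 0 0] cell_translate[of i j 0 0 1]
    by (simp, metis add.commute add.left_commute add_0)
  have box: "(+) (lattice_point i j) ` (cell 0 0 0 \<union> cell 0 0 1) = strip_box i j" for i j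
    unfolding image_Un lower upper by (rule cell_Un)
  have tiling: "lattice_tiling = (\<lambda>v. (+) v ` cell 0 0 0) ` V \<union> (\<lambda>v. (+) v ` cell 0 0 1) ` V"
  proof -
    have "f ` V = (\<Union>i j. {f (lattice_point i j)})" for f :: "real^2 \<Rightarrow> (real^2) set"
      unfolding V_def by fastforce
    then have "(\<lambda>v. (+) v ` cell 0 0 0) ` V = (\<Union>i j. {cell i j (i + j)})"
      "(\<lambda>v. (+) v ` cell 0 0 1) ` V = (\<Union>i j. {cell i j (i + j + 1)})"
      by (simp_all only: lower upper)
    then show ?thesis
      unfolding lattice_tiling_def by (simp only:) blast
  qed
  have "tiles_plane_by_translation (cell 0 0 0 \<union> cell 0 0 1) V"
    unfolding tiles_plane_by_translation_def
  proof (intro conjI ballI impI)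
    have "x \<in> strip_box \<lfloor>fst_coord x\<rfloor> \<lfloor>snd_coord x\<rfloor>" for x
      unfolding strip_box_def by simp
    then show "(\<Union>v\<in>V. (+) v ` (cell 0 0 0 \<union> cell 0 0 1)) = UNIV"
      unfolding V_def using box by fastforce
    fix v w assume "v \<in> V" "w \<in> V" "v \<noteq> w"
    then obtain i j i' j' where "v = lattice_point i j" "w = lattice_point i' j'" "(i, j) \<noteq> (i', j')"
      unfolding V_def by auto
    then show "interior ((+) v ` (cell 0 0 0 \<union> cell 0 0 1)) \<inter> interior ((+) w ` (cell 0 0 0 \<union> cell 0 0 1)) = {}"
      using interior_strip_box_Int box by simp
  qed
  moreover have "cell 0 0 1 = (+) (lattice_point 1 1) ` uminus ` cell 0 0 0"
    using cell_reflect[of 1 1 0 0 0] by (simp add: image_image)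
  moreover have "2 simplex cell 0 0 0"
    by (intro lattice_tiling_simplex cell_in_lattice_tiling) simp
  moreover have "parallelogram (cell 0 0 0 \<union> cell 0 0 1)"
    using parallelogram_strip_box cell_Un[of 0 0] by simp
  ultimately show ?thesis
    unfolding parallelogram_tiling_def using plane_triangulation_lattice_tiling tiling by blast
qed

text \<open>Each square in \<open>c (2 (s + t)^2 - s^2 - t^2)\<close> is replaced by its
  interpolant; the shift \<open>d\<close> becomes the deviation at the lattice points.\<close>

definition lattice_interpolant :: "real \<Rightarrow> real \<Rightarrow> real^2 \<Rightarrow> real" where
  "lattice_interpolant c d x = c * (2 * square_interpolant (fst_coord x + snd_coord x)
     - square_interpolant (fst_coord x) - square_interpolant (snd_coord x)) + d"

lemma lattice_interpolant_affine:
  assumes "S \<in> lattice_tiling"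
  shows "\<exists>h b. linear h \<and> (\<forall>x\<in>S. lattice_interpolant c d x = h x + b)"
proof -
  obtain i j k where S: "S = cell i j k"
    using assms by (rule lattice_tiling_cases)
  define h where "h x = c * (2 * ((2 * real_of_int k + 1) * (fst_coord x + snd_coord x))
     - (2 * real_of_int i + 1) * fst_coord x - (2 * real_of_int j + 1) * snd_coord x)" for x
  define b where "b = d - c * (2 * (k * (real_of_int k + 1)) - i * (real_of_int i + 1) - j * (real_of_int j + 1))"
  have "linear h"
    by (rule linearI) (simp_all add: h_def coords_simps algebra_simps)
  moreover have "lattice_interpolant c d x = h x + b" if "x \<in> S" for x
    using that unfolding S mem_cell lattice_interpolant_def h_def b_def
    by (simp add: square_interpolant_interval[of k] square_interpolant_interval[of i] square_interpolant_interval[of j] algebra_simps)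
  ultimately show ?thesis by blast
qed

text \<open>The error is \<open>c * D + d\<close> with \<open>D\<close> between -1/2 and 1/4, and
  the hypotheses on \<open>c\<close> and \<open>d\<close> keep both extremes within
  \<open>\<epsilon>\<close>. At lattice points \<open>D\<close> vanishes.\<close>

lemma lattice_interpolant_approximation:
  assumes quad: "\<And>x. xy x = c * (2 * (fst_coord x + snd_coord x)\<^sup>2 - (fst_coord x)\<^sup>2 - (snd_coord x)\<^sup>2)"
    and bounds: "c \<ge> 0" "d + c / 4 \<le> \<epsilon>" "c / 2 - d \<le> \<epsilon>"
  shows "pl_approximation \<epsilon> xy lattice_tiling (lattice_interpolant c d)"
    and "constant_deviation xy lattice_tiling (lattice_interpolant c d) d"
proof -
  have "continuous_on UNIV (lattice_interpolant c d)"
    unfolding lattice_interpolant_def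
    by (intro continuous_intros continuous_on_compose2[OF continuous_on_square_interpolant] continuous_coords) auto
  moreover have "\<bar>lattice_interpolant c d x - xy x\<bar> \<le> \<epsilon>" for x
  proof -
    define \<psi> where "\<psi> t = square_interpolant t - t\<^sup>2" for t
    define D where "D = 2 * \<psi> (fst_coord x + snd_coord x) - \<psi> (fst_coord x) - \<psi> (snd_coord x)"
    have "lattice_interpolant c d x - xy x = c * D + d"
      by (simp add: lattice_interpolant_def quad D_def \<psi>_def algebra_simps)
    moreover have "- (1 / 2) \<le> D" "D \<le> 1 / 4"
      using square_interpolant_combination_bounds[of "fst_coord x" "snd_coord x"] by (simp_all add: D_def \<psi>_def)
    then have "c * - (1 / 2) \<le> c * D" "c * D \<le> c * (1 / 4)"
      using bounds(1) by (intro mult_left_mono; simp)+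
    ultimately show ?thesis
      using bounds by (simp add: abs_le_iff)
  qed
  ultimately show "pl_approximation \<epsilon> xy lattice_tiling (lattice_interpolant c d)"
    unfolding pl_approximation_def using lattice_interpolant_affine by blast
  have at_lattice: "lattice_interpolant c d (lattice_point i j) - xy (lattice_point i j) = d" for i j
    unfolding lattice_interpolant_def quad coords_lattice_point
    by (simp add: square_interpolant_of_int flip: of_int_add)
  have "\<exists>i j. v = lattice_point i j" if "S \<in> lattice_tiling" "v extreme_point_of S" for S v
    using that cross2_basis unfolding lattice_tiling_def cell_lower_eq cell_upper_eq
    by (auto simp: extreme_point_of_triangle cross2_lattice_triangles) blast+
  then show "constant_deviation xy lattice_tiling (lattice_interpolant c d) d"
    unfolding constant_deviation_def triangulation_vertices_def using at_lattice by fastforce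
qed

end

subsection \<open>The optimal density\<close>

text \<open>
  The basis solves \<open>xy e = xy g = 8\<epsilon>/3\<close> and \<open>xy (e - g) = -16\<epsilon>/3\<close>.
\<close>

lemma exists_optimal_lattice_tiling:
  assumes eps: "\<epsilon> > 0"
  shows "\<exists>\<T> f S. parallelogram_tiling \<T> \<and> pl_approximation \<epsilon> xy \<T> f \<and>
    constant_deviation xy \<T> f (\<epsilon> / 3) \<and> S \<in> \<T> \<and> measure lborel S = 8 * sqrt 3 / 3 * \<epsilon>"
proof -
  \<comment> \<open>With \<open>g\<close> the mirror image of \<open>e\<close> in the diagonal, the
    conditions become \<open>p * q = 8/3 \<epsilon>\<close> and
    \<open>(p - q)^2 = 16/3 \<epsilon>\<close>; \<open>s\<close> is \<open>p - q\<close>.\<close>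
  define s where "s = sqrt (16 / 3 * \<epsilon>)"
  define p q where "p = s * (sqrt 3 + 1) / 2" and "q = s * (sqrt 3 - 1) / 2"
  define e g :: "real^2" where "e = vector [p, q]" and "g = vector [q, p]"
  have s2: "s * s = 16 / 3 * \<epsilon>"
    using eps by (simp add: s_def)
  have pq: "p * q = 8 / 3 * \<epsilon>" "p * p + q * q = 4 * (8 / 3 * \<epsilon>)" "p * p - q * q = sqrt 3 * (16 / 3 * \<epsilon>)"
  proof -
    have "p * q = s * s / 2" "p * p + q * q = 2 * (s * s)" "p * p - q * q = sqrt 3 * (s * s)"
      by (simp_all add: p_def q_def field_simps)
    then show "p * q = 8 / 3 * \<epsilon>" "p * p + q * q = 4 * (8 / 3 * \<epsilon>)" "p * p - q * q = sqrt 3 * (16 / 3 * \<epsilon>)"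
      unfolding s2 by simp_all
  qed
  have cross: "cross2 e g = sqrt 3 * (16 / 3 * \<epsilon>)"
    using pq(3) by (simp add: cross2_def e_def g_def)
  have "cross2 e g \<noteq> 0"
    unfolding cross using eps by simp
  then interpret plane_basis e g
    by unfold_locales
  have quad: "xy x = 8 / 3 * \<epsilon> * (2 * (fst_coord x + snd_coord x)\<^sup>2 - (fst_coord x)\<^sup>2 - (snd_coord x)\<^sup>2)" for x
  proof -
    have "xy (a *\<^sub>R e + b *\<^sub>R g) = (a * a + b * b) * (p * q) + a * b * (p * p + q * q)" for a b
      by (simp add: xy_def e_def g_def algebra_simps)
    then have "xy (a *\<^sub>R e + b *\<^sub>R g) = 8 / 3 * \<epsilon> * (2 * (a + b)\<^sup>2 - a\<^sup>2 - b\<^sup>2)" for a b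
      unfolding pq by (simp add: power2_eq_square algebra_simps)
    from this[of "fst_coord x" "snd_coord x"] show ?thesis
      by (simp only: coords_expansion)
  qed
  \<comment> \<open>The shift \<open>\<epsilon> / 3\<close> balances the two sides:
    \<open>d + c / 4\<close> and \<open>c / 2 - d\<close> both equal
    \<open>\<epsilon>\<close>.\<close>
  let ?f = "lattice_interpolant (8 / 3 * \<epsilon>) (\<epsilon> / 3)"
  have "pl_approximation \<epsilon> xy lattice_tiling ?f" "constant_deviation xy lattice_tiling ?f (\<epsilon> / 3)"
    by (rule lattice_interpolant_approximation[where \<epsilon> = \<epsilon>, OF quad]; use eps in simp)+
  moreover have "measure lborel (cell 0 0 (0 + 0)) = 8 * sqrt 3 / 3 * \<epsilon>"
    unfolding cell_lower_eq content_triangle_cross2 cross2_lattice_triangles cross using eps by simp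
  moreover have "cell 0 0 (0 + 0) \<in> lattice_tiling"
    by (intro cell_in_lattice_tiling) simp
  ultimately show ?thesis
    using parallelogram_tiling_lattice_tiling by blast
qed

theorem theorem1p3:
  fixes F :: "real^2 \<Rightarrow> real" and \<epsilon> :: real
  assumes F: "\<And>p. F p = p $ 1 * p $ 2"
    and eps: "\<epsilon> > 0"
  shows "optimal_density \<epsilon> F = ereal (sqrt 3 / (8 * \<epsilon>)) \<and>
    (\<exists>\<T> f. optimal_tiling \<epsilon> F \<T> f \<and> constant_deviation F \<T> f (\<epsilon> / 3)) \<and>
    (\<forall>\<T> f. optimal_tiling \<epsilon> F \<T> f \<longrightarrow>
       (\<forall>S\<in>\<T>. measure lborel S = 8 * sqrt 3 / 3 * \<epsilon>) \<and>
       (constant_deviation F \<T> f (\<epsilon> / 3) \<or> constant_deviation F \<T> f (- \<epsilon> / 3)))"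
proof -
  define A where "A = 8 * sqrt 3 / 3 * \<epsilon>"
  have F_xy: "F = xy"
    by (rule ext) (simp add: F xy_def)
  have A: "A > 0" "1 / A = sqrt 3 / (8 * \<epsilon>)"
    using eps by (simp_all add: A_def field_simps)
  have lower: "ereal (1 / A) \<le> triangle_density \<T>"
    if tiling: "parallelogram_tiling \<T>" and f: "pl_approximation \<epsilon> xy \<T> f" for \<T> f
  proof -
    have tri: "plane_triangulation \<T>"
      using tiling by (simp add: parallelogram_tiling_def)
    obtain S where S: "S \<in> \<T>"
      using plane_triangulation_cover[OF tri, of 0] by blast
    obtain a b c where abc: "cross2 (b - a) (c - a) \<noteq> 0" "S = convex hull {a, b, c}"
      using plane_triangulation_simplex[OF tri S] unfolding simplex_2_iff by blast
    have "measure lborel S \<le> A"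
      using tiling_triangle_area(1)[OF eps tiling f _ abc(1)] S by (simp add: A_def abc(2))
    then show ?thesis
      using parallelogram_tiling_density(1,3)[OF tiling S] by (simp add: frac_le)
  qed
  obtain \<T>\<^sub>0 f\<^sub>0 S\<^sub>0 where opt: "parallelogram_tiling \<T>\<^sub>0" "pl_approximation \<epsilon> xy \<T>\<^sub>0 f\<^sub>0"
    "constant_deviation xy \<T>\<^sub>0 f\<^sub>0 (\<epsilon> / 3)" "S\<^sub>0 \<in> \<T>\<^sub>0" "measure lborel S\<^sub>0 = A"
    using exists_optimal_lattice_tiling[OF eps] unfolding A_def by blast
  have density: "triangle_density \<T>\<^sub>0 = ereal (1 / A)"
    using parallelogram_tiling_density(1)[OF opt(1,4)] opt(5) by simp
  have optimal: "optimal_density \<epsilon> xy = ereal (1 / A)"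
    unfolding optimal_density_def
  proof (rule antisym)
    show "(INF \<T>\<in>{\<T>. parallelogram_tiling \<T> \<and> (\<exists>f. pl_approximation \<epsilon> xy \<T> f)}. triangle_density \<T>) \<le> ereal (1 / A)"
      using opt density by (intro INF_lower2[of \<T>\<^sub>0]) auto
    show "ereal (1 / A) \<le> (INF \<T>\<in>{\<T>. parallelogram_tiling \<T> \<and> (\<exists>f. pl_approximation \<epsilon> xy \<T> f)}. triangle_density \<T>)"
      using lower by (intro INF_greatest) auto
  qed
  have "(\<forall>S\<in>\<T>. measure lborel S = A) \<and>
      (constant_deviation xy \<T> f (\<epsilon> / 3) \<or> constant_deviation xy \<T> f (- \<epsilon> / 3))"
    if "optimal_tiling \<epsilon> xy \<T> f" for \<T> f
  proof -
    have T: "parallelogram_tiling \<T>" "pl_approximation \<epsilon> xy \<T> f" "triangle_density \<T> = ereal (1 / A)"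
      using that optimal by (auto simp: optimal_tiling_def)
    \<comment> \<open>The density is the reciprocal of the common area, so attaining the optimum
      fixes the area of every member.\<close>
    have area: "measure lborel S = A" if S: "S \<in> \<T>" for S
    proof -
      have "1 / measure lborel S = 1 / A"
        using parallelogram_tiling_density(1)[OF T(1) S] T(3) by simp
      then show ?thesis
        using A(1) parallelogram_tiling_density(3)[OF T(1) S] by (simp add: field_simps)
    qed
    then show ?thesis
      using optimal_triangle_constant_deviation[OF eps T(1,2)] unfolding A_def by blast
  qed
  moreover have "optimal_tiling \<epsilon> xy \<T>\<^sub>0 f\<^sub>0"
    unfolding optimal_tiling_def optimal using opt density by simp
  ultimately show ?thesis
    unfolding F_xy optimal A(2)[symmetric] A_def[symmetric] using opt(3) by blast
qed

end
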